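(* Let $n\ge k\ge 2$ be integers. There exists a ${}^2\mathrm{H}(n;k)$ if and only if $k\ge 3$ and $nk\not\equiv 1\pmod 4$.
   Context: For positive integers $m,n,s,k,\lambda,t$ with $t$ dividing $\frac{2nk}{\lambda}$, let $v=\frac{2nk}{\lambda}+t$ and $J$ the subgroup of $\mathbb{Z}_v$ of order $t$. A ${}^\lambda\mathrm{H}_t(m,n;s,k)$ is an $m\times n$ partially filled array with entries in $\mathbb{Z}_v$ such that: (a) each row has exactly $s$ and each column exactly $k$ filled cells; (b) the multiset $\{\pm x: x$ an entry of a filled cell$\}$ contains each element of $\mathbb{Z}_v\setminus J$ exactly $\lambda$ times and no element of $J$; (c) every row and every column sums to $0$ in $\mathbb{Z}_v$. When $t=1$ the subscript is omitted, and when $m=n$ (hence $s=k$) the array is denoted ${}^\lambda\mathrm{H}_t(n;k)$. Thus ${}^2\mathrm{H}(n;k)$ is an $n\times n$ array over $\mathbb{Z}_{nk+1}$ with $k$ filled cells in each row and column. *)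

theory Defs
  imports Main "HOL-Library.Multiset"
begin

text \<open>A partially filled n x n array: A i j = None means the cell (i,j) is empty,
  A i j = Some x means it is filled with x. Elements of Z_v are represented by
  their canonical representatives in {0..<v}.\<close>

definition filled_cells :: "nat \<Rightarrow> (nat \<Rightarrow> nat \<Rightarrow> int option) \<Rightarrow> (nat \<times> nat) set" where
  "filled_cells n A = {(i,j). i < n \<and> j < n \<and> A i j \<noteq> None}"

definition entries :: "nat \<Rightarrow> (nat \<Rightarrow> nat \<Rightarrow> int option) \<Rightarrow> int multiset" where
  "entries n A = image_mset (\<lambda>(i,j). the (A i j)) (mset_set (filled_cells n A))"

definition cellval :: "int option \<Rightarrow> int" where
  "cellval c = (case c of None \<Rightarrow> 0 | Some y \<Rightarrow> y)"

text \<open>A ^2H(n;k): lambda = 2, t = 1, v = 2nk/2 + 1 = nk + 1, J = {0}.\<close>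
definition is_H2 :: "nat \<Rightarrow> nat \<Rightarrow> (nat \<Rightarrow> nat \<Rightarrow> int option) \<Rightarrow> bool" where
  "is_H2 n k A \<longleftrightarrow>
     (let v = int (n * k + 1) in
       (\<forall>i j. A i j \<noteq> None \<longrightarrow> i < n \<and> j < n) \<and>
       (\<forall>i j x. A i j = Some x \<longrightarrow> 0 \<le> x \<and> x < v) \<and>
       (\<forall>i<n. card {j. j < n \<and> A i j \<noteq> None} = k) \<and>
       (\<forall>j<n. card {i. i < n \<and> A i j \<noteq> None} = k) \<and>
       (let M = entries n A + image_mset (\<lambda>y. (- y) mod v) (entries n A) in
          \<forall>x\<in>{0..<v}. count M x = (if x = 0 then 0 else 2)) \<and>
       (\<forall>i<n. (\<Sum>j<n. cellval (A i j)) mod v = 0) \<and>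
       (\<forall>j<n. (\<Sum>i<n. cellval (A i j)) mod v = 0))"

end

theory Submission
  imports Defs
begin

text \<open>
  \<^emph>\<open>Necessity.\<close> If k = 2, then the two further entries in the row and in the column of a cell with entry x
  are both -x, so the class of x occurs three times. If nk = 1 (mod 4), then v = nk + 1 is
  2 (mod 4); negation preserves parity in \<open>\<int>\<close>/v, so condition (b) leaves exactly v/2 odd entries, an odd
  number, although the sum of all entries is 0 modulo the even number v.

  \<^emph>\<open>Sufficiency.\<close> We construct integer arrays whose rows and columns sum to 0 in \<open>\<int>\<close> and whose absolute values
  are 1, ..., \<open>\<lfloor>nk/2\<rfloor>\<close> together with 1, ..., \<open>\<lceil>nk/2\<rceil>\<close>; reduced modulo v these satisfy (b). The arrays consist of k
  cyclic diagonals. Two adjacent diagonals carrying s+1, -(s+2), s+3, -(s+4), ... along their zigzag have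
  constant row sums -1 and column sums 1 (outside one column); adding such a pair and the negative of
  another one on four free diagonals passes from k to k + 4, using up the next 2n labels on both lists.

  There remain the cases k = 0, 6, 3, 5. For k = 6 three pairs of diagonals in arithmetic progression
  with differences 1, 1, -2 suffice. For k = 3 the array is symmetric up to a cyclic shift, with a
  cyclic sequence y next to the main diagonal and the negated sums of neighbours of y on it; y is composed of two
  alternating runs of consecutive absolute values, whose neighbour sums are again consecutive. For
  k = 5 one adds a pair of diagonals whose i-th row and column sums agree (T i), and replaces the
  neighbour sums of y by those plus T.
\<close>

subsection \<open>Label multisets\<close>

definition ivl :: "int \<Rightarrow> int \<Rightarrow> int multiset" where
  "ivl a b = mset_set {a..<b}"

lemma ivl_empty [simp]: "b \<le> a \<Longrightarrow> ivl a b = {#}"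
  by (simp add: ivl_def)

lemma ivl_join: "a \<le> b \<Longrightarrow> b \<le> c \<Longrightarrow> ivl a b + ivl b c = ivl a c"
  unfolding ivl_def by (subst mset_set_Union [symmetric]) (auto simp: ivl_disj_un)

lemma ivl_singleton: "ivl a (a + 1) = {#a#}"
proof -
  have "{a..<a + 1} = {a}" by auto
  then show ?thesis by (simp add: ivl_def)
qed

lemma ivl_snoc: "a \<le> b \<Longrightarrow> ivl a (b + 1) = add_mset b (ivl a b)"
  using ivl_join [of a b "b + 1"] by (simp add: ivl_singleton)

lemma ivl_snoc': "a \<le> b \<Longrightarrow> c = b + 1 \<Longrightarrow> ivl a c = add_mset b (ivl a b)"
  by (simp add: ivl_snoc)

lemma ivl_cons: "a \<le> b \<Longrightarrow> ivl (a - 1) b = add_mset (a - 1) (ivl a b)"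
  using ivl_join [of "a - 1" a b] ivl_singleton [of "a - 1"] by simp

lemma image_ivl_reflect: "image_mset (\<lambda>t. c - t) (ivl a b) = ivl (c - b + 1) (c - a + 1)"
proof -
  have "(\<lambda>t. c - t) ` {a..<b} = {c - b + 1..<c - a + 1}"
  proof (intro set_eqI iffI)
    fix x assume "x \<in> {c - b + 1..<c - a + 1}"
    then have "c - x \<in> {a..<b}" "x = c - (c - x)" by auto
    then show "x \<in> (\<lambda>t. c - t) ` {a..<b}" by blast
  qed auto
  then show ?thesis
    unfolding ivl_def by (subst image_mset_mset_set) (auto simp: inj_on_def)
qed

lemma ivl_cons': "c < b \<Longrightarrow> a = c + 1 \<Longrightarrow> ivl c b = add_mset c (ivl a b)"
  using ivl_cons [of a b] by simp

section \<open>Multisets of absolute values of finite sequences\<close>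

definition labels :: "nat \<Rightarrow> (nat \<Rightarrow> int) \<Rightarrow> int multiset" where
  "labels n f = image_mset (\<lambda>i. \<bar>f i\<bar>) (mset_set {..<n})"

lemma labels_0 [simp]: "labels 0 f = {#}"
  by (simp add: labels_def)

lemma labels_Suc: "labels (Suc n) f = add_mset \<bar>f n\<bar> (labels n f)"
  by (simp add: labels_def lessThan_Suc)

lemma labels_cong: "(\<And>i. i < n \<Longrightarrow> \<bar>f i\<bar> = \<bar>g i\<bar>) \<Longrightarrow> labels n f = labels n g"
  unfolding labels_def by (intro image_mset_cong) auto

lemma labels_add: "labels (m + n) f = labels m f + labels n (\<lambda>i. f (m + i))"
  by (induction n) (simp_all add: labels_Suc)

lemma labels_Suc_shift: "labels (Suc n) f = add_mset \<bar>f 0\<bar> (labels n (\<lambda>i. f (Suc i)))"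
  using labels_add [of 1 n f] by (simp add: labels_Suc)

lemma labels_up: "0 \<le> c \<Longrightarrow> labels l (\<lambda>i. c + int i) = ivl c (c + int l)"
proof (induction l)
  case (Suc l)
  have "ivl c (c + int l + 1) = add_mset (c + int l) (ivl c (c + int l))"
    by (rule ivl_snoc) simp
  moreover have "c + int (Suc l) = c + int l + 1" by simp
  ultimately show ?case using Suc by (simp only: labels_Suc) simp
qed simp

lemma labels_down: "int l \<le> c + 1 \<Longrightarrow> labels l (\<lambda>i. c - int i) = ivl (c - int l + 1) (c + 1)"
proof (induction l)
  case (Suc l)
  have "ivl (c - int l + 1 - 1) (c + 1) = add_mset (c - int l + 1 - 1) (ivl (c - int l + 1) (c + 1))"
    by (rule ivl_cons) simp
  then show ?case using Suc by (simp add: labels_Suc)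
qed simp

lemma labels_interleave:
  "0 \<le> c \<Longrightarrow> labels l (\<lambda>i. c + 2 * int i) + labels l (\<lambda>i. c + 1 + 2 * int i) = ivl c (c + 2 * int l)"
proof (induction l)
  case (Suc l)
  have "ivl c (c + 2 * int l + 1 + 1) = add_mset (c + 2 * int l + 1) (add_mset (c + 2 * int l) (ivl c (c + 2 * int l)))"
    using Suc.prems ivl_snoc [of c "c + 2 * int l"] ivl_snoc [of c "c + 2 * int l + 1"] by simp
  moreover have "c + 2 * int (Suc l) = c + 2 * int l + 1 + 1" by simp
  ultimately show ?case using Suc by (simp add: labels_Suc algebra_simps)
qed simp

text \<open>Row i meets diagonal d in column i + d and diagonal d + 1 one column further on. A
  function of \<open>cyc_pred n j\<close> placed on diagonal d + 1 is thus read off, along a row, at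
  the same index as a function of \<open>j\<close> placed on diagonal d.\<close>

definition cyc_pred :: "nat \<Rightarrow> nat \<Rightarrow> nat" where
  "cyc_pred n j = (if j = 0 then n - 1 else j - 1)"

lemma cyc_pred_0 [simp]: "cyc_pred n 0 = n - 1" and cyc_pred_Suc [simp]: "cyc_pred n (Suc j) = j"
  by (simp_all add: cyc_pred_def)

lemma cyc_pred_Suc_mod: "0 < n \<Longrightarrow> cyc_pred n (Suc i mod n) = i mod n"
  by (auto simp: mod_Suc cyc_pred_def)

lemma labels_cyc_pred: "labels n (\<lambda>j. f (cyc_pred n j)) = labels n f"
proof (cases n)
  case (Suc k)
  have "labels (Suc k) (\<lambda>j. f (cyc_pred (Suc k) j)) = add_mset \<bar>f k\<bar> (labels k f)"
    by (subst labels_Suc_shift) simp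
  then show ?thesis using Suc by (simp add: labels_Suc)
qed simp

section \<open>Alternating sequences and their cyclic concatenation\<close>

definition zig :: "int \<Rightarrow> int \<Rightarrow> nat \<Rightarrow> int" where
  "zig A B i = (if even i then A - int (i div 2) else B - int (i div 2))"

text \<open>In A, B, A - 1, B - 1, ... each move to the next adjacent pair replaces one term by that
  term minus one. The neighbour sums are therefore consecutive integers for any A and B.\<close>

lemma zig_step: "zig A B (Suc i) + zig A B i = A + B - int i"
  by (cases "even i") (auto simp: zig_def elim!: evenE oddE)

lemma labels_uminus: "labels n (\<lambda>i. - f i) = labels n f"
  by (rule labels_cong) simp

text \<open>The terms at even positions descend from A, while those at odd positions ascend from -B
  in absolute value; the bound on \<open>l\<close> prevents the first kind from passing below 0.
  With suitable A and B the two intervals are adjacent and merge into one.\<close>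

lemma labels_zig_pos:
  assumes "B \<le> 0"
  shows "int ((l + 1) div 2) \<le> A + 1 \<Longrightarrow>
    labels l (zig A B) = ivl (A + 1 - int ((l + 1) div 2)) (A + 1) + ivl (- B) (- B + int (l div 2))"
proof (induction l)
  case (Suc l)
  show ?case
  proof (cases "even l")
    case True
    then obtain j where l: "l = 2 * j" by (elim evenE)
    have "ivl (A - int j + 1 - 1) (A + 1) = add_mset (A - int j + 1 - 1) (ivl (A - int j + 1) (A + 1))"
      by (rule ivl_cons) simp
    with Suc l show ?thesis by (simp add: labels_Suc zig_def algebra_simps)
  next
    case False
    then obtain j where l: "l = 2 * j + 1" by (elim oddE)
    have "ivl (- B) (- B + int j + 1) = add_mset (- B + int j) (ivl (- B) (- B + int j))"
      by (rule ivl_snoc) simp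
    with Suc l assms show ?thesis by (simp add: labels_Suc zig_def algebra_simps)
  qed
qed simp

text \<open>The mirror case: now the even positions ascend in absolute value and the odd ones
  descend.\<close>

lemma labels_zig_neg:
  assumes "A \<le> 0"
  shows "int (l div 2) \<le> B + 1 \<Longrightarrow>
    labels l (zig A B) = ivl (- A) (- A + int ((l + 1) div 2)) + ivl (B + 1 - int (l div 2)) (B + 1)"
proof (induction l)
  case (Suc l)
  show ?case
  proof (cases "even l")
    case True
    then obtain j where l: "l = 2 * j" by (elim evenE)
    have "ivl (- A) (- A + int j + 1) = add_mset (- A + int j) (ivl (- A) (- A + int j))"
      by (rule ivl_snoc) simp
    with Suc l assms show ?thesis by (simp add: labels_Suc zig_def algebra_simps)
  next
    case False
    then obtain j where l: "l = 2 * j + 1" by (elim oddE)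
    have "ivl (B - int j + 1 - 1) (B + 1) = add_mset (B - int j + 1 - 1) (ivl (B - int j + 1) (B + 1))"
      by (rule ivl_cons) simp
    with Suc l show ?thesis by (simp add: labels_Suc zig_def algebra_simps)
  qed
qed simp

lemma zig_even [simp]: "zig A B (2 * j) = A - int j" and zig_odd [simp]: "zig A B (2 * j + 1) = B - int j"
  by (simp_all add: zig_def)

lemma zig_0 [simp]: "zig A B 0 = A"
  by (simp add: zig_def)

definition join_at :: "nat \<Rightarrow> (nat \<Rightarrow> int) \<Rightarrow> (nat \<Rightarrow> int) \<Rightarrow> nat \<Rightarrow> int" where
  "join_at l u v i = (if i < l then u i else v (i - l))"

lemma labels_join_at: "labels (l + m) (join_at l u v) = labels l u + labels m v"
  unfolding labels_add by (intro arg_cong2 [where f = "(+)"] labels_cong) (simp_all add: join_at_def)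

text \<open>Going once round the cycle, every neighbour sum lies inside \<open>u\<close> or inside
  \<open>v\<close>, except at the two junctions, at indices 0 and \<open>Suc a\<close>. The summand
  \<open>T\<close> is 0 for three diagonals and carries the correction for five.\<close>

lemma labels_join_at_adjacent:
  fixes u v T :: "nat \<Rightarrow> int" and a b :: nat
  defines "y \<equiv> join_at (Suc a) u v"
  shows "labels (Suc a + Suc b) (\<lambda>j. y j + y (cyc_pred (Suc a + Suc b) j) + T j) =
    {#\<bar>u 0 + v b + T 0\<bar>, \<bar>v 0 + u a + T (Suc a)\<bar>#} + labels a (\<lambda>i. u (Suc i) + u i + T (Suc i))
    + labels b (\<lambda>i. v (Suc i) + v i + T (Suc (Suc a) + i))"
proof -
  define f where "f = (\<lambda>j. y j + y (cyc_pred (Suc a + Suc b) j) + T j)"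
  have "labels (Suc a + Suc b) f = labels (Suc a) f + labels (Suc b) (\<lambda>i. f (Suc a + i))"
    by (rule labels_add)
  also have "labels (Suc a) f = add_mset \<bar>f 0\<bar> (labels a (\<lambda>i. f (Suc i)))"
    by (rule labels_Suc_shift)
  also have "labels a (\<lambda>i. f (Suc i)) = labels a (\<lambda>i. u (Suc i) + u i + T (Suc i))"
    by (rule labels_cong) (simp add: f_def y_def join_at_def)
  also have "f 0 = u 0 + v b + T 0"
    by (simp add: f_def y_def join_at_def)
  also have "labels (Suc b) (\<lambda>i. f (Suc a + i)) = add_mset \<bar>f (Suc a)\<bar> (labels b (\<lambda>i. f (Suc a + Suc i)))"
    by (subst labels_Suc_shift) simp
  also have "f (Suc a) = v 0 + u a + T (Suc a)"
    by (simp add: f_def y_def join_at_def)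
  also have "labels b (\<lambda>i. f (Suc a + Suc i)) = labels b (\<lambda>i. v (Suc i) + v i + T (Suc (Suc a) + i))"
    by (rule labels_cong) (simp add: f_def y_def join_at_def)
  finally show ?thesis by (simp add: f_def)
qed

subsection \<open>Diagonal schemes\<close>

text \<open>The offset of a cell (i, j) is j - i modulo n, and S is the set of offsets of the filled diagonals.
  Note that \<open>F d j\<close> is the entry on diagonal d in \<^emph>\<open>column\<close> j, that is, in row j - d.\<close>

definition scheme :: "nat \<Rightarrow> nat set \<Rightarrow> (nat \<Rightarrow> nat \<Rightarrow> int) \<Rightarrow> nat \<Rightarrow> nat \<Rightarrow> bool" where
  "scheme n S F p q \<longleftrightarrow> S \<subseteq> {..<n} \<and>
     (\<forall>j<n. (\<Sum>d\<in>S. F d j) = 0) \<and>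
     (\<forall>i<n. (\<Sum>d\<in>S. F d ((i + d) mod n)) = 0) \<and>
     (\<Sum>d\<in>S. labels n (F d)) = ivl 1 (int p + 1) + ivl 1 (int q + 1)"

text \<open>A pair started at s has column sum 1, except in column 0, where it is 1 - 2n. Neither
  this value nor the row sum -1 depends on s, so a pair started at p and the negative of one started
  at q cancel in every row and column.\<close>

lemma scheme_add_four:
  assumes F: "scheme n S F p q" and d: "Suc d < n" and e: "Suc e < n" "Suc d < e"
    and notin: "d \<notin> S" "Suc d \<notin> S" "e \<notin> S" "Suc e \<notin> S"
  shows "\<exists>F'. scheme n (S \<union> {d, Suc d, e, Suc e}) F' (p + 2 * n) (q + 2 * n)"
proof -
  define b where "b = (\<lambda>s j. int s + 1 + 2 * int j)"
  define F' where "F' = F(d := b p, Suc d := (\<lambda>j. - (b p (cyc_pred n j) + 1)),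
    e := (\<lambda>j. - b q j), Suc e := (\<lambda>j. b q (cyc_pred n j) + 1))"
  have fin: "finite S" using F finite_subset by (auto simp: scheme_def)
  have n: "0 < n" using d by simp
  have old: "F' c = F c" if "c \<in> S" for c
    using that notin by (auto simp: F'_def)
  have split: "(\<Sum>c\<in>S \<union> {d, Suc d, e, Suc e}. g c) = (\<Sum>c\<in>S. g c) + (g d + g (Suc d) + g e + g (Suc e))"
    for g :: "nat \<Rightarrow> 'b::comm_monoid_add"
  proof -
    have "(\<Sum>c\<in>S \<union> {d, Suc d, e, Suc e}. g c) = (\<Sum>c\<in>S. g c) + (\<Sum>c\<in>{d, Suc d, e, Suc e}. g c)"
      using fin notin by (intro sum.union_disjoint) auto
    also have "(\<Sum>c\<in>{d, Suc d, e, Suc e}. g c) = g d + g (Suc d) + g e + g (Suc e)"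
      using e by (simp add: add.assoc)
    finally show ?thesis .
  qed
  have new: "F' d = b p" "F' (Suc d) = (\<lambda>j. - (b p (cyc_pred n j) + 1))"
    "F' e = (\<lambda>j. - b q j)" "F' (Suc e) = (\<lambda>j. b q (cyc_pred n j) + 1)"
    using e by (auto simp: F'_def)
  have lab: "labels n (b s) + labels n (\<lambda>j. b s (cyc_pred n j) + 1) = ivl (int s + 1) (int s + 2 * int n + 1)" for s :: nat
    using labels_interleave [of "int s + 1" n] labels_cyc_pred [of n "\<lambda>j. b s j + 1"]
    by (simp add: b_def algebra_simps)
  have "scheme n (S \<union> {d, Suc d, e, Suc e}) F' (p + 2 * n) (q + 2 * n)"
    unfolding scheme_def
  proof (intro conjI allI impI)
    show "S \<union> {d, Suc d, e, Suc e} \<subseteq> {..<n}"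
      using F d e by (auto simp: scheme_def)
    fix j assume j: "j < n"
    have "(\<Sum>c\<in>S. F' c j) = 0" using F j old by (simp add: scheme_def)
    then show "(\<Sum>c\<in>S \<union> {d, Suc d, e, Suc e}. F' c j) = 0"
      by (simp only: split new) (simp add: b_def)
    have "(\<Sum>c\<in>S. F' c ((j + c) mod n)) = 0" using F j old by (simp add: scheme_def)
    then show "(\<Sum>c\<in>S \<union> {d, Suc d, e, Suc e}. F' c ((j + c) mod n)) = 0"
      by (simp only: split new add_Suc_right cyc_pred_Suc_mod [OF n])
  next
    have "(\<Sum>c\<in>S. labels n (F' c)) = ivl 1 (int p + 1) + ivl 1 (int q + 1)"
      using F old by (simp add: scheme_def)
    then have "(\<Sum>c\<in>S \<union> {d, Suc d, e, Suc e}. labels n (F' c)) =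
        ivl 1 (int p + 1) + ivl 1 (int q + 1)
        + (labels n (b p) + labels n (\<lambda>j. b p (cyc_pred n j) + 1))
        + (labels n (b q) + labels n (\<lambda>j. b q (cyc_pred n j) + 1))"
      by (simp only: split new labels_uminus) (simp add: ac_simps)
    also have "\<dots> = (ivl 1 (int p + 1) + ivl (int p + 1) (int p + 2 * int n + 1))
        + (ivl 1 (int q + 1) + ivl (int q + 1) (int q + 2 * int n + 1))"
      unfolding lab by (simp add: ac_simps)
    also have "\<dots> = ivl 1 (int (p + 2 * n) + 1) + ivl 1 (int (q + 2 * n) + 1)"
      by (simp add: ivl_join)
    finally show "(\<Sum>c\<in>S \<union> {d, Suc d, e, Suc e}. labels n (F' c)) =
      ivl 1 (int (p + 2 * n) + 1) + ivl 1 (int (q + 2 * n) + 1)" .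
  qed
  then show ?thesis by blast
qed

text \<open>The function \<open>g\<close> enumerates 2t disjoint pairs of adjacent free diagonals,
  which are consumed two at a time.\<close>

lemma scheme_add_fours:
  assumes F: "scheme n S F p q"
    and g: "\<And>i. i < 2 * t \<Longrightarrow> g i \<notin> S \<and> Suc (g i) \<notin> S \<and> Suc (g i) < n"
    and sep: "\<And>i j. j < i \<Longrightarrow> i < 2 * t \<Longrightarrow> Suc (g j) < g i"
  shows "\<exists>S' F'. scheme n S' F' (p + 2 * n * t) (q + 2 * n * t) \<and> card S' = card S + 4 * t"
proof -
  \<comment> \<open>The last conjunct records that only pairs with index below 2s have been used,
    which shows that the next two pairs are still free.\<close>
  have "\<exists>S' F'. scheme n S' F' (p + 2 * n * s) (q + 2 * n * s) \<and> card S' = card S + 4 * s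
      \<and> (\<forall>x\<in>S'. x \<in> S \<or> (\<exists>j<2 * s. x = g j \<or> x = Suc (g j)))" if "s \<le> t" for s
    using that
  proof (induction s)
    case 0
    have "scheme n S F (p + 2 * n * 0) (q + 2 * n * 0)" using F by simp
    then show ?case by auto
  next
    case (Suc s)
    from Suc.IH [OF Suc_leD [OF Suc.prems]]
    obtain S' F' where S': "scheme n S' F' (p + 2 * n * s) (q + 2 * n * s)"
      and card: "card S' = card S + 4 * s"
      and sub: "\<And>x. x \<in> S' \<Longrightarrow> x \<in> S \<or> (\<exists>j<2 * s. x = g j \<or> x = Suc (g j))" by blast
    define d e where "d = g (2 * s)" and "e = g (2 * s + 1)"
    have fresh: "x \<notin> S'" if x: "x = g i \<or> x = Suc (g i)" and i: "2 * s \<le> i" "i < 2 * t" for x i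
    proof
      assume "x \<in> S'"
      then consider "x \<in> S" | j where "j < 2 * s" "x = g j \<or> x = Suc (g j)"
        using sub by blast
      then show False
      proof cases
        case 1
        then show ?thesis using g [OF i(2)] x by blast
      next
        case 2
        have "j < i" using 2(1) i(1) by linarith
        from sep [OF this i(2)] 2(2) x show ?thesis by linarith
      qed
    qed
    have lt: "2 * s < 2 * t" "2 * s + 1 < 2 * t" using Suc.prems by linarith+
    have de: "Suc d < n" "Suc e < n" "Suc d < e" "d \<notin> S'" "Suc d \<notin> S'" "e \<notin> S'" "Suc e \<notin> S'"
      unfolding d_def e_def
      using g [OF lt(1)] g [OF lt(2)] sep [OF _ lt(2), of "2 * s"] fresh [OF _ _ lt(1)] fresh [OF _ _ lt(2)]
      by simp_all
    let ?S = "S' \<union> {d, Suc d, e, Suc e}"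
    obtain F'' where "scheme n ?S F'' (p + 2 * n * s + 2 * n) (q + 2 * n * s + 2 * n)"
      using scheme_add_four [OF S' de] by (elim exE)
    then have F'': "scheme n ?S F'' (p + 2 * n * Suc s) (q + 2 * n * Suc s)"
      by (simp add: algebra_simps)
    have fin: "finite S'" using S' finite_subset [of S' "{..<n}"] by (simp add: scheme_def)
    have "card ?S = card S' + card {d, Suc d, e, Suc e}"
      using de fin by (subst card_Un_disjoint) auto
    also have "card {d, Suc d, e, Suc e} = 4" using de(3) by simp
    finally have "card ?S = card S + 4 * Suc s" using card by simp
    moreover have "x \<in> S \<or> (\<exists>j<2 * Suc s. x = g j \<or> x = Suc (g j))" if x: "x \<in> ?S" for x
    proof -
      consider "x \<in> S'" | "x = g (2 * s) \<or> x = Suc (g (2 * s))" | "x = g (2 * s + 1) \<or> x = Suc (g (2 * s + 1))"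
        using x unfolding d_def e_def by blast
      then show ?thesis
      proof cases
        case 1
        from sub [OF this] show ?thesis
        proof (elim disjE exE conjE)
          fix j assume "j < 2 * s"
          then have "j < 2 * Suc s" by simp
          then show ?thesis if "x = g j" using that by blast
          show ?thesis if "x = Suc (g j)" using \<open>j < 2 * Suc s\<close> that by blast
        qed simp
      next
        case 2
        moreover have "2 * s < 2 * Suc s" by simp
        ultimately show ?thesis by blast
      next
        case 3
        moreover have "2 * s + 1 < 2 * Suc s" by simp
        ultimately show ?thesis by blast
      qed
    qed
    ultimately show ?case using F'' by blast
  qed
  from this [OF order_refl] show ?thesis by blast
qed

section \<open>Cyclic arithmetic relating rows, columns and offsets\<close>

lemma cyc_diff:
  fixes i j n :: nat
  assumes "i < n" "j < n"
  shows "(j + n - i) mod n = (if i \<le> j then j - i else j + n - i)"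
proof (cases "i \<le> j")
  case True
  then have "(j + n - i) mod n = (j - i + n) mod n" by simp
  also have "\<dots> = j - i" using assms by simp
  finally show ?thesis using True by simp
qed (use assms in simp)

lemma cyc_add:
  fixes i d n :: nat
  assumes "i < n" "d < n"
  shows "(i + d) mod n = (if i + d < n then i + d else i + d - n)"
proof (cases "i + d < n")
  case False
  then have "(i + d) mod n = (i + d - n) mod n" by (intro le_mod_geq) simp
  then show ?thesis using False assms by simp
qed simp

lemma offset_row:
  fixes i d n :: nat
  assumes "i < n" "d < n"
  shows "((i + d) mod n + n - i) mod n = d"
  using cyc_add [OF assms] cyc_diff [of i n "(i + d) mod n"] assms by (simp split: if_splits)

lemma row_offset:
  fixes i j n :: nat
  assumes "i < n" "j < n"
  shows "(i + (j + n - i) mod n) mod n = j"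
  using cyc_diff [OF assms] cyc_add [of i n "(j + n - i) mod n"] assms by (simp split: if_splits)

lemma offset_col:
  fixes d j n :: nat
  assumes "d < n" "j < n"
  shows "(j + n - (j + n - d) mod n) mod n = d"
  using cyc_diff [OF assms] cyc_diff [of "(j + n - d) mod n" n j] assms by (simp split: if_splits)

section \<open>Reduction modulo v and passage from schemes to arrays\<close>

lemma ivl_mod: "0 \<le> a \<Longrightarrow> b \<le> v \<Longrightarrow> image_mset (\<lambda>t. t mod v) (ivl a b) = ivl a b"
  unfolding ivl_def by (subst (2) multiset.map_ident [symmetric]) (intro image_mset_cong, auto)

lemma ivl_uminus_mod:
  assumes "1 \<le> a" "b \<le> v"
  shows "image_mset (\<lambda>t. (- t) mod v) (ivl a b) = ivl (v - b + 1) (v - a + 1)"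
proof -
  have "image_mset (\<lambda>t. (- t) mod v) (ivl a b) = image_mset (\<lambda>t. v - t) (ivl a b)"
  proof (rule image_mset_cong)
    fix t assume "t \<in># ivl a b"
    then have "1 \<le> t" "t < v" using assms by (auto simp: ivl_def)
    then show "(- t) mod v = v - t" by (simp add: zmod_zminus1_eq_if)
  qed
  then show ?thesis by (simp add: image_ivl_reflect)
qed

text \<open>This is why a scheme only has to control absolute values: condition (b) concerns x and
  -x together.\<close>

lemma abs_mod_pair:
  fixes x v :: int
  shows "{#x mod v, (- x) mod v#} = {#\<bar>x\<bar> mod v, (- \<bar>x\<bar>) mod v#}"
  by (cases "0 \<le> x") auto

text \<open>Zero sums over the integers remain zero modulo v, and the two label lists complement
  each other modulo v = p + q + 1.\<close>

lemma is_H2_of_scheme: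
  assumes F: "scheme n S F p q" and pq: "p + q = n * card S"
  shows "\<exists>A. is_H2 n (card S) A"
proof (cases "n = 0")
  case True
  then show ?thesis using F
    by (intro exI [of _ "\<lambda>_ _. None"]) (auto simp: is_H2_def scheme_def entries_def filled_cells_def)
next
  case False
  then have n: "0 < n" by simp
  define v where "v = int (n * card S + 1)"
  have "0 < v" unfolding v_def of_nat_0_less_iff by simp
  have v: "v = int p + int q + 1" using pq by (simp add: v_def flip: of_nat_add)
  define A where "A = (\<lambda>i j. if i < n \<and> j < n \<and> (j + n - i) mod n \<in> S
    then Some (F ((j + n - i) mod n) j mod v) else None)"
  have S: "S \<subseteq> {..<n}" "finite S"
    using F finite_subset by (auto simp: scheme_def)
  have cols: "(\<Sum>d\<in>S. F d j) = 0" if "j < n" for j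
    using F that unfolding scheme_def by blast
  have rows: "(\<Sum>d\<in>S. F d ((i + d) mod n)) = 0" if "i < n" for i
    using F that unfolding scheme_def by blast
  define C where "C = filled_cells n A"
  have C: "C = {(i, j). i < n \<and> j < n \<and> (j + n - i) mod n \<in> S}"
    by (auto simp: C_def filled_cells_def A_def)
  \<comment> \<open>Filled cells are parametrized by offset and column, the coordinates in which
    \<open>F\<close> is given.\<close>
  have bij: "bij_betw (\<lambda>(d, j). ((j + n - d) mod n, j)) (S \<times> {..<n}) C"
  proof (rule bij_betw_byWitness [where f' = "\<lambda>(i, j). ((j + n - i) mod n, j)"])
    have inv: "(j + n - (j + n - d) mod n) mod n = d" if "j < n" "d < n" for j d
      using offset_col that by blast
    show "\<forall>a\<in>S \<times> {..<n}. (case case a of (d, j) \<Rightarrow> ((j + n - d) mod n, j) of (i, j) \<Rightarrow> ((j + n - i) mod n, j)) = a"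
      using S inv by auto
    show "\<forall>a\<in>C. (case case a of (i, j) \<Rightarrow> ((j + n - i) mod n, j) of (d, j) \<Rightarrow> ((j + n - d) mod n, j)) = a"
      using inv by (auto simp: C)
    show "(\<lambda>(d, j). ((j + n - d) mod n, j)) ` (S \<times> {..<n}) \<subseteq> C"
      using S inv n by (auto simp: C)
    show "(\<lambda>(i, j). ((j + n - i) mod n, j)) ` C \<subseteq> S \<times> {..<n}"
      by (auto simp: C)
  qed
  define E where "E = image_mset (\<lambda>(d, j). F d j) (mset_set (S \<times> {..<n}))"
  have entries: "entries n A = image_mset (\<lambda>x. x mod v) E"
  proof -
    have "mset_set C = image_mset (\<lambda>(d, j). ((j + n - d) mod n, j)) (mset_set (S \<times> {..<n}))"
      using bij by (subst image_mset_mset_set) (auto simp: bij_betw_def)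
    then have "entries n A = image_mset (\<lambda>a. case (case a of (d, j) \<Rightarrow> ((j + n - d) mod n, j)) of (i, j) \<Rightarrow> the (A i j))
        (mset_set (S \<times> {..<n}))"
      by (simp add: entries_def flip: C_def) (simp add: multiset.map_comp comp_def)
    also have "\<dots> = image_mset (\<lambda>a. (case a of (d, j) \<Rightarrow> F d j) mod v) (mset_set (S \<times> {..<n}))"
    proof (rule image_mset_cong)
      fix a assume "a \<in># mset_set (S \<times> {..<n})"
      then obtain d j where a: "a = (d, j)" "d \<in> S" "j < n" "d < n" using S by (cases a) auto
      have "(j + n - (j + n - d) mod n) mod n = d" using a offset_col by blast
      then show "(case (case a of (d, j) \<Rightarrow> ((j + n - d) mod n, j)) of (i, j) \<Rightarrow> the (A i j)) =
          (case a of (d, j) \<Rightarrow> F d j) mod v"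
        using a n by (simp add: A_def)
    qed
    finally show ?thesis by (simp add: E_def multiset.map_comp comp_def)
  qed
  have abs_E: "image_mset abs E = ivl 1 (int p + 1) + ivl 1 (int q + 1)"
  proof -
    have "image_mset abs E = image_mset (\<lambda>(d, j). \<bar>F d j\<bar>) (mset_set (S \<times> {..<n}))"
      by (simp add: E_def multiset.map_comp comp_def split_def)
    also have "\<dots> = (\<Sum>d\<in>S. labels n (F d))"
      using \<open>finite S\<close>
    proof (induction S rule: finite_induct)
      case (insert d S)
      have "mset_set (insert d S \<times> {..<n}) = mset_set (Pair d ` {..<n}) + mset_set (S \<times> {..<n})"
        using insert by (subst mset_set_Union [symmetric]) (auto intro!: arg_cong [of _ _ mset_set])
      also have "mset_set (Pair d ` {..<n}) = image_mset (Pair d) (mset_set {..<n})"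
        by (subst image_mset_mset_set) (auto simp: inj_on_def)
      finally show ?case
        using insert by (simp add: labels_def multiset.map_comp comp_def)
    qed simp
    finally show ?thesis using F by (simp add: scheme_def)
  qed
  have M: "entries n A + image_mset (\<lambda>y. (- y) mod v) (entries n A) = ivl 1 v + ivl 1 v"
  proof -
    have "entries n A + image_mset (\<lambda>y. (- y) mod v) (entries n A) =
        image_mset (\<lambda>x. x mod v) E + image_mset (\<lambda>x. (- x) mod v) E"
      by (simp add: entries multiset.map_comp comp_def mod_minus_eq)
    also have "\<dots> = image_mset (\<lambda>t. t mod v) (image_mset abs E) + image_mset (\<lambda>t. (- t) mod v) (image_mset abs E)"
    proof (induction E)
      case (add x E)
      then show ?case using abs_mod_pair [of x v]
        by (simp add: add_mset_commute)
    qed simp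
    \<comment> \<open>Negating 1, ..., q modulo v gives p + 1, ..., v - 1, exactly what 1, ..., p
      lacks; negating 1, ..., p completes 1, ..., q in the same way.\<close>
    also have "\<dots> = (ivl 1 (int p + 1) + ivl (int p + 1) v) + (ivl 1 (int q + 1) + ivl (int q + 1) v)"
      unfolding abs_E image_mset_union by (simp add: ivl_mod ivl_uminus_mod v ac_simps)
    also have "\<dots> = ivl 1 v + ivl 1 v"
      by (simp add: ivl_join v)
    finally show ?thesis .
  qed
  have "is_H2 n (card S) A"
    unfolding is_H2_def Let_def v_def [symmetric]
  proof (intro conjI allI impI ballI)
    show "i < n" "j < n" if "A i j \<noteq> None" for i j
      using that by (auto simp: A_def split: if_splits)
    show "0 \<le> x" "x < v" if "A i j = Some x" for i j x
    proof -
      have "x = F ((j + n - i) mod n) j mod v"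
        using that by (auto simp: A_def split: if_splits)
      then show "0 \<le> x" "x < v" using \<open>0 < v\<close> by simp_all
    qed
  next
    fix i assume i: "i < n"
    have cells: "{j. j < n \<and> A i j \<noteq> None} = (\<lambda>d. (i + d) mod n) ` S"
    proof (intro set_eqI iffI)
      fix j assume "j \<in> {j. j < n \<and> A i j \<noteq> None}"
      then have "(j + n - i) mod n \<in> S" "j < n"
        by (auto simp: A_def split: if_splits)
      then have "(j + n - i) mod n \<in> S" "j = (i + (j + n - i) mod n) mod n"
        using row_offset [OF i] by simp_all
      then show "j \<in> (\<lambda>d. (i + d) mod n) ` S" by blast
    next
      fix j assume "j \<in> (\<lambda>d. (i + d) mod n) ` S"
      then obtain d where d: "d \<in> S" "j = (i + d) mod n" by blast
      then have "d < n" "j < n" using S n by auto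
      then show "j \<in> {j. j < n \<and> A i j \<noteq> None}"
        using i d offset_row [of i n d] by (simp add: A_def)
    qed
    have inj: "inj_on (\<lambda>d. (i + d) mod n) S"
      proof (rule inj_on_inverseI [where g = "\<lambda>j. (j + n - i) mod n"])
      fix d assume "d \<in> S"
      then have "d < n" using S by auto
      then show "((i + d) mod n + n - i) mod n = d" by (rule offset_row [OF i])
    qed
    show "card {j. j < n \<and> A i j \<noteq> None} = card S"
      unfolding cells using inj by (rule card_image)
    have "(\<Sum>j<n. cellval (A i j)) = (\<Sum>j\<in>{j. j < n \<and> A i j \<noteq> None}. cellval (A i j))"
      by (rule sum.mono_neutral_right) (auto simp: cellval_def)
    also have "\<dots> = (\<Sum>d\<in>S. cellval (A i ((i + d) mod n)))"
      unfolding cells by (simp add: sum.reindex [OF inj])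
    also have "\<dots> = (\<Sum>d\<in>S. F d ((i + d) mod n) mod v)"
    proof (rule sum.cong [OF refl])
      fix d assume d: "d \<in> S"
      then have "d < n" using S by auto
      then show "cellval (A i ((i + d) mod n)) = F d ((i + d) mod n) mod v"
        using i n d offset_row [of i n d] by (simp add: A_def cellval_def)
    qed
    finally show "(\<Sum>j<n. cellval (A i j)) mod v = 0"
      using rows [OF i] by (simp add: mod_sum_eq)
  next
    fix j assume j: "j < n"
    have inv: "(j + n - (j + n - i) mod n) mod n = i" if "i < n" for i
      using j that offset_col by blast
    have cells: "{i. i < n \<and> A i j \<noteq> None} = (\<lambda>d. (j + n - d) mod n) ` S"
    proof (intro set_eqI iffI)
      fix i assume "i \<in> {i. i < n \<and> A i j \<noteq> None}"
      then have "(j + n - i) mod n \<in> S" "i < n"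
        by (auto simp: A_def split: if_splits)
      then have "(j + n - i) mod n \<in> S" "i = (j + n - (j + n - i) mod n) mod n"
        using inv by simp_all
      then show "i \<in> (\<lambda>d. (j + n - d) mod n) ` S" by blast
    next
      fix i assume "i \<in> (\<lambda>d. (j + n - d) mod n) ` S"
      then obtain d where d: "d \<in> S" "i = (j + n - d) mod n" by blast
      then have "d < n" "i < n" using S n by auto
      then show "i \<in> {i. i < n \<and> A i j \<noteq> None}"
        using j d inv [of d] by (simp add: A_def)
    qed
    have inj: "inj_on (\<lambda>d. (j + n - d) mod n) S"
      proof (rule inj_on_inverseI [where g = "\<lambda>i. (j + n - i) mod n"])
      fix d assume "d \<in> S"
      then have "d < n" using S by auto
      then show "(j + n - (j + n - d) mod n) mod n = d" by (rule inv)
    qed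
    show "card {i. i < n \<and> A i j \<noteq> None} = card S"
      unfolding cells using inj by (rule card_image)
    have "(\<Sum>i<n. cellval (A i j)) = (\<Sum>i\<in>{i. i < n \<and> A i j \<noteq> None}. cellval (A i j))"
      by (rule sum.mono_neutral_right) (auto simp: cellval_def)
    also have "\<dots> = (\<Sum>d\<in>S. cellval (A ((j + n - d) mod n) j))"
      unfolding cells by (simp add: sum.reindex [OF inj])
    also have "\<dots> = (\<Sum>d\<in>S. F d j mod v)"
    proof (rule sum.cong [OF refl])
      fix d assume d: "d \<in> S"
      then have "d < n" using S by auto
      then show "cellval (A ((j + n - d) mod n) j) = F d j mod v"
        using j n d inv [of d] by (simp add: A_def cellval_def)
    qed
    finally show "(\<Sum>i<n. cellval (A i j)) mod v = 0"
      using cols [OF j] by (simp add: mod_sum_eq)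
  next
    fix x assume "x \<in> {0..<v}"
    then show "count (entries n A + image_mset (\<lambda>y. (- y) mod v) (entries n A)) x = (if x = 0 then 0 else 2)"
      unfolding M by (auto simp: ivl_def)
  qed
  then show ?thesis by blast
qed

lemma ex_is_H2:
  assumes F: "scheme n S F p q" and pq: "p + q = n * card S"
    and g: "\<And>i. i < 2 * t \<Longrightarrow> g i \<notin> S \<and> Suc (g i) \<notin> S \<and> Suc (g i) < n"
    and sep: "\<And>i j. j < i \<Longrightarrow> i < 2 * t \<Longrightarrow> Suc (g j) < g i"
    and k: "k = card S + 4 * t"
  shows "\<exists>A. is_H2 n k A"
proof -
  obtain S' F' where "scheme n S' F' (p + 2 * n * t) (q + 2 * n * t)" "card S' = card S + 4 * t"
    using scheme_add_fours [of n S F p q t g, OF F g sep] by blast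
  moreover have "(p + 2 * n * t) + (q + 2 * n * t) = n * (card S + 4 * t)"
    using pq by (simp add: algebra_simps)
  ultimately show ?thesis
    using is_H2_of_scheme [of n S' F' "p + 2 * n * t" "q + 2 * n * t"] k by simp
qed

subsection \<open>Base cases\<close>

lemma scheme_empty: "scheme n {} F 0 0"
  by (simp add: scheme_def)

text \<open>The pairs (0, 1), (2, 3), (4, 5) have constant row sums 2n + 1, -2n and -1. The sum of a
  pair in column j is its row sum plus its slope times \<open>j - cyc_pred n j\<close>, and the
  slopes 1, 1, -2 add up to 0, so column 0 is no exception.\<close>

lemma scheme_six:
  assumes "6 \<le> n"
  shows "\<exists>F. scheme n {0, 1, 2, 3, 4, 5} F (3 * n) (3 * n)"
proof -
  define F where "F = (\<lambda>(d::nat) j.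
    if d = 0 then 1 + int j
    else if d = 1 then 2 * int n - int (cyc_pred n j)
    else if d = 2 then 1 + int j
    else if d = 3 then - (2 * int n + 1 + int (cyc_pred n j))
    else if d = 4 then 3 * int n - 1 - 2 * int j
    else 2 * int (cyc_pred n j) - 3 * int n)"
  have n: "0 < n" using assms by simp
  have pred: "cyc_pred n ((i + 1) mod n) = i mod n" "cyc_pred n ((i + 3) mod n) = (i + 2) mod n"
    "cyc_pred n ((i + 5) mod n) = (i + 4) mod n" for i
    using cyc_pred_Suc_mod [OF n, of i] cyc_pred_Suc_mod [OF n, of "i + 2"] cyc_pred_Suc_mod [OF n, of "i + 4"]
    by (simp_all add: eval_nat_numeral)
  have lab: "labels n (F 0) = ivl 1 (1 + int n)" "labels n (F 2) = ivl 1 (1 + int n)"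
    "labels n (F 1) = ivl (int n + 1) (2 * int n + 1)"
    "labels n (F 3) = ivl (2 * int n + 1) (3 * int n + 1)"
    "labels n (F 4) + labels n (F 5) = ivl (int n + 1) (3 * int n + 1)"
  proof -
    show "labels n (F 0) = ivl 1 (1 + int n)" "labels n (F 2) = ivl 1 (1 + int n)"
      by (simp_all add: F_def labels_up)
    show "labels n (F 1) = ivl (int n + 1) (2 * int n + 1)"
      using labels_cyc_pred [of n "\<lambda>j. 2 * int n - int j"] labels_down [of n "2 * int n"] by (simp add: F_def)
    have "labels n (F 3) = labels n (\<lambda>j. 2 * int n + 1 + int j)"
      using labels_cyc_pred [of n "\<lambda>j. - (2 * int n + 1 + int j)"] labels_uminus [of n "\<lambda>j. 2 * int n + 1 + int j"]
      by (simp add: F_def)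
    then show "labels n (F 3) = ivl (2 * int n + 1) (3 * int n + 1)"
      by (simp add: labels_up)
    \<comment> \<open>On diagonals 4 and 5 the absolute values descend in steps of two; reversing
      the index gives the ascending form of \<open>labels_interleave\<close>.\<close>
    have rev: "labels n (\<lambda>j. f (n - 1 - j)) = labels n f" for f
    proof -
      have "mset_set {..<n} = image_mset (\<lambda>j. n - 1 - j) (mset_set {..<n})"
      proof (subst image_mset_mset_set)
        show "inj_on (\<lambda>j. n - 1 - j) {..<n}" by (auto simp: inj_on_def)
        have "(\<lambda>j. n - 1 - j) ` {..<n} = {..<n}"
        proof (intro set_eqI iffI)
          fix x assume "x \<in> {..<n}"
          then have "x = n - 1 - (n - 1 - x)" "n - 1 - x \<in> {..<n}" by auto
          then show "x \<in> (\<lambda>j. n - 1 - j) ` {..<n}" by blast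
        qed auto
        then show "mset_set {..<n} = mset_set ((\<lambda>j. n - 1 - j) ` {..<n})" by simp
      qed
      then show ?thesis unfolding labels_def by (metis (no_types, lifting) image_mset.compositionality comp_def image_mset_cong)
    qed
    have "labels n (F 4) = labels n (\<lambda>j. int n + 1 + 2 * int j)"
      unfolding rev [of "F 4", symmetric] by (rule labels_cong) (auto simp: F_def of_nat_diff)
    moreover have "labels n (F 5) = labels n (\<lambda>j. int n + 1 + 1 + 2 * int j)"
    proof -
      have "labels n (F 5) = labels n (\<lambda>j. 2 * int j - 3 * int n)"
        using labels_cyc_pred [of n "\<lambda>j. 2 * int j - 3 * int n"] by (simp add: F_def)
      also have "\<dots> = labels n (\<lambda>j. int n + 1 + 1 + 2 * int j)"
        unfolding rev [of "\<lambda>j. 2 * int j - 3 * int n", symmetric] by (rule labels_cong) (auto simp: of_nat_diff)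
      finally show ?thesis .
    qed
    ultimately show "labels n (F 4) + labels n (F 5) = ivl (int n + 1) (3 * int n + 1)"
      using labels_interleave [of "int n + 1" n] by simp
  qed
  have "scheme n {0, 1, 2, 3, 4, 5} F (3 * n) (3 * n)"
    unfolding scheme_def
  proof (intro conjI allI impI)
    show "{0, 1, 2, 3, 4, 5} \<subseteq> {..<n}" using assms by auto
    show "(\<Sum>d\<in>{0, 1, 2, 3, 4, 5}. F d j) = 0" for j
      by (simp add: F_def)
    show "(\<Sum>d\<in>{0, 1, 2, 3, 4, 5}. F d ((i + d) mod n)) = 0" for i
      using pred [of i] by (simp add: F_def)
    have "(\<Sum>d\<in>{0, 1, 2, 3, 4, 5}. labels n (F d)) =
        (ivl 1 (1 + int n) + ivl (int n + 1) (2 * int n + 1) + ivl (2 * int n + 1) (3 * int n + 1))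
        + (ivl 1 (1 + int n) + ivl (int n + 1) (3 * int n + 1))"
      using lab by (simp add: ac_simps)
    also have "\<dots> = ivl 1 (int (3 * n) + 1) + ivl 1 (int (3 * n) + 1)"
      by (simp add: ivl_join add.commute)
    finally show "(\<Sum>d\<in>{0, 1, 2, 3, 4, 5}. labels n (F d)) = ivl 1 (int (3 * n) + 1) + ivl 1 (int (3 * n) + 1)" .
  qed
  then show ?thesis by blast
qed

text \<open>Every row and every column contains two cyclically adjacent values of \<open>y\<close>
  and their negated sum. Three diagonals thus reduce to a labelling question about one cyclic
  sequence, whose own labels count twice.\<close>

lemma scheme_three:
  assumes "3 \<le> n"
    and lab: "labels n y + labels n y + labels n (\<lambda>j. y j + y (cyc_pred n j)) = ivl 1 (int p + 1) + ivl 1 (int q + 1)"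
  shows "\<exists>F. scheme n {0, 1, 2} F p q"
proof -
  define F where "F = (\<lambda>(d::nat) j.
    if d = 0 then y j else if d = 1 then - (y j + y (cyc_pred n j)) else y (cyc_pred n j))"
  have n: "0 < n" using assms by simp
  have "scheme n {0, 1, 2} F p q"
    unfolding scheme_def
  proof (intro conjI allI impI)
    show "{0, 1, 2} \<subseteq> {..<n}" using assms by auto
    show "(\<Sum>d\<in>{0, 1, 2}. F d j) = 0" for j
      by (simp add: F_def)
    show "(\<Sum>d\<in>{0, 1, 2}. F d ((i + d) mod n)) = 0" for i
      using cyc_pred_Suc_mod [OF n, of i] cyc_pred_Suc_mod [OF n, of "Suc i"] by (simp add: F_def)
    have "F 0 = y" "labels n (F 1) = labels n (\<lambda>j. y j + y (cyc_pred n j))" "labels n (F 2) = labels n y"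
      using labels_uminus [of n "\<lambda>j. y j + y (cyc_pred n j)"] labels_cyc_pred [of n y] by (simp_all add: F_def)
    then show "(\<Sum>d\<in>{0, 1, 2}. labels n (F d)) = ivl 1 (int p + 1) + ivl 1 (int q + 1)"
      using lab by (simp add: ac_simps)
  qed
  then show ?thesis by blast
qed

text \<open>The assumption on a says that the pair of diagonals L + 1 and L + 2, whose column sums are T by
  construction, also has row sums T (up to the shift by one between row and column indices).\<close>

lemma scheme_five:
  assumes "2 \<le> L" "L + 2 < n"
    and a: "\<And>t. t < n \<Longrightarrow> a ((t + L) mod n) - a ((t + L + 1) mod n) + T ((t + L + 1) mod n) = T t"
    and lab: "labels n y + labels n y + labels n (\<lambda>j. y j + y (cyc_pred n j) + T j)
      + labels n a + labels n (\<lambda>j. T j - a j) = ivl 1 (int p + 1) + ivl 1 (int q + 1)"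
  shows "\<exists>F. scheme n {0, 1, 2, L + 1, L + 2} F p q"
proof -
  define F where "F = (\<lambda>(d::nat) j.
    if d = 0 then y j else if d = 1 then - (y j + y (cyc_pred n j) + T j) else if d = 2 then y (cyc_pred n j)
    else if d = L + 1 then a j else T j - a j)"
  have n: "0 < n" using assms by simp
  have sum: "(\<Sum>d\<in>{0, 1, 2, L + 1, L + 2}. g d) = g 0 + g 1 + g 2 + g (L + 1) + g (L + 2)"
    for g :: "nat \<Rightarrow> 'b::comm_monoid_add"
    using assms(1) by (simp add: add.assoc)
  have F: "F 0 = y" "F 1 = (\<lambda>j. - (y j + y (cyc_pred n j) + T j))" "F 2 = (\<lambda>j. y (cyc_pred n j))"
    "F (L + 1) = a" "F (L + 2) = (\<lambda>j. T j - a j)"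
    using assms(1) by (simp_all add: F_def fun_eq_iff)
  have "scheme n {0, 1, 2, L + 1, L + 2} F p q"
    unfolding scheme_def
  proof (intro conjI allI impI)
    show "{0, 1, 2, L + 1, L + 2} \<subseteq> {..<n}" using assms by auto
    show "(\<Sum>d\<in>{0, 1, 2, L + 1, L + 2}. F d j) = 0" for j
      unfolding sum F by simp
    fix i assume "i < n"
    \<comment> \<open>Row i meets diagonal 1 in column t, where the entry contains
      \<open>- T t\<close>; the extra pair of diagonals must return \<open>T t\<close> in this
      row.\<close>
    define t where "t = Suc i mod n"
    have "t < n" using n by (simp add: t_def)
    have y: "y (cyc_pred n t) = y (i mod n)" "y (cyc_pred n (Suc (Suc i) mod n)) = y t"
      unfolding t_def using cyc_pred_Suc_mod [OF n] by simp_all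
    have "(t + L) mod n = (i + (L + 1)) mod n" "(t + L + 1) mod n = (i + (L + 2)) mod n"
      unfolding t_def using mod_add_left_eq [of "Suc i" n L] mod_add_left_eq [of "Suc i" n "L + 1"]
      by (simp_all add: add.assoc)
    then have "a ((i + (L + 1)) mod n) - a ((i + (L + 2)) mod n) + T ((i + (L + 2)) mod n) = T t"
      using a [OF \<open>t < n\<close>] by simp
    moreover have "(i + 1) mod n = t" "(i + 2) mod n = Suc (Suc i) mod n" "(i + 0) mod n = i mod n"
      by (simp_all add: t_def)
    ultimately show "(\<Sum>d\<in>{0, 1, 2, L + 1, L + 2}. F d ((i + d) mod n)) = 0"
      unfolding sum F using y by simp
  next
    show "(\<Sum>d\<in>{0, 1, 2, L + 1, L + 2}. labels n (F d)) = ivl 1 (int p + 1) + ivl 1 (int q + 1)"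
      unfolding sum F labels_uminus labels_cyc_pred using lab by (simp add: ac_simps)
  qed
  then show ?thesis by blast
qed

section \<open>Explicit cyclic sequences for three and five diagonals\<close>

lemma labels_eq_ivl_up: "0 \<le> c \<Longrightarrow> (\<And>i. i < l \<Longrightarrow> \<bar>f i\<bar> = c + int i) \<Longrightarrow> labels l f = ivl c (c + int l)"
  using labels_up [of c l] labels_cong [of l f "\<lambda>i. c + int i"] by simp

lemma labels_eq_ivl_down:
  assumes "int l \<le> c + 1" "\<And>i. i < l \<Longrightarrow> \<bar>f i\<bar> = c - int i"
  shows "labels l f = ivl (c - int l + 1) (c + 1)"
proof -
  have "labels l f = labels l (\<lambda>i. c - int i)"
    using assms by (intro labels_cong) simp
  then show ?thesis using labels_down [OF assms(1)] by simp
qed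

text \<open>The absolute values of \<open>u\<close> are 4m+5+3r, ..., 6m+6+3r and those of
  \<open>v\<close> are 2m+3+r, ..., 4m+4+3r. The neighbour sums must then cover 1, ..., 2m+2+r
  twice: \<open>u\<close> gives 1, ..., 2m+1, \<open>v\<close> gives 1, ..., 2m+1+2r, and the
  junctions add 2m+2 and 2m+2+r.\<close>

lemma ex_scheme_three_even:
  assumes "r \<le> 1"
  shows "\<exists>F. scheme (4 * m + 4 + 2 * r) {0, 1, 2} F (6 * m + 6 + 3 * r) (6 * m + 6 + 3 * r)"
proof -
  define u where "u = (\<lambda>i. - zig (6 * int m + 6 + 3 * int r) (- (4 * int m + 5 + 3 * int r)) i)"
  define v where "v = (\<lambda>i. - zig (3 * int m + 3 + 2 * int r) (- (3 * int m + 4 + 2 * int r)) i)"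
  define a b where "a = 2 * m + 1" and "b = 2 * (m + r) + 1"
  define y where "y = join_at (Suc a) u v"
  have n: "4 * m + 4 + 2 * r = Suc a + Suc b" by (simp add: a_def b_def)
  have u: "u (Suc i) + u i = int i - (2 * int m + 1)" for i
    using zig_step [of "6 * int m + 6 + 3 * int r" "- (4 * int m + 5 + 3 * int r)" i] by (simp add: u_def)
  have v: "v (Suc i) + v i = 1 + int i" for i
    using zig_step [of "3 * int m + 3 + 2 * int r" "- (3 * int m + 4 + 2 * int r)" i] by (simp add: v_def)
  have yl: "labels (Suc a + Suc b) y = ivl (2 * int m + 3 + int r) (6 * int m + 7 + 3 * int r)"
  proof -
    have "labels (Suc a) u = ivl (5 * int m + 6 + 3 * int r) (6 * int m + 7 + 3 * int r)
        + ivl (4 * int m + 5 + 3 * int r) (5 * int m + 6 + 3 * int r)"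
      unfolding u_def labels_uminus by (subst labels_zig_pos) (simp_all add: a_def algebra_simps)
    moreover have "labels (Suc b) v = ivl (2 * int m + 3 + int r) (3 * int m + 4 + 2 * int r)
        + ivl (3 * int m + 4 + 2 * int r) (4 * int m + 5 + 3 * int r)"
      unfolding v_def labels_uminus by (subst labels_zig_pos) (simp_all add: b_def algebra_simps)
    ultimately show ?thesis
      unfolding y_def labels_join_at by (simp add: ivl_join union_commute)
  qed
  have ends: "\<bar>u 0 + v b + 0\<bar> = 2 * int m + 2" "\<bar>v 0 + u a + 0\<bar> = 2 * int m + 2 + int r"
    unfolding a_def b_def u_def v_def zig_even zig_odd zig_0 by simp_all
  have xl: "labels (Suc a + Suc b) (\<lambda>j. y j + y (cyc_pred (Suc a + Suc b) j)) =
      {#2 * int m + 2, 2 * int m + 2 + int r#} + ivl 1 (2 * int m + 2) + ivl 1 (2 * int m + 2 * int r + 2)"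
  proof -
    have "labels a (\<lambda>i. u (Suc i) + u i + 0) = ivl 1 (2 * int m + 2)"
      by (rule trans [OF labels_eq_ivl_down [of _ "2 * int m + 1"] arg_cong2 [of _ _ _ _ ivl]]) (auto simp: u a_def)
    moreover have "labels b (\<lambda>i. v (Suc i) + v i + 0) = ivl 1 (2 * int m + 2 * int r + 2)"
      by (rule trans [OF labels_eq_ivl_up [of 1] arg_cong [of _ _ "ivl 1"]]) (auto simp: v b_def)
    ultimately show ?thesis
      using labels_join_at_adjacent [of a b u v "\<lambda>_. 0"] ends by (simp add: y_def)
  qed
  have "\<exists>F. scheme (Suc a + Suc b) {0, 1, 2} F (6 * m + 6 + 3 * r) (6 * m + 6 + 3 * r)"
  proof (rule scheme_three)
    show "3 \<le> Suc a + Suc b" by (simp add: a_def b_def)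
    consider "r = 0" | "r = 1" using assms by linarith
    then have low: "{#2 * int m + 2, 2 * int m + 2 + int r#} + ivl 1 (2 * int m + 2) + ivl 1 (2 * int m + 2 * int r + 2)
        = ivl 1 (2 * int m + 3 + int r) + ivl 1 (2 * int m + 3 + int r)"
    proof cases
      case 1
      have "ivl 1 (2 * int m + 3) = add_mset (2 * int m + 2) (ivl 1 (2 * int m + 2))"
        by (rule ivl_snoc') simp_all
      with 1 show ?thesis by simp
    next
      case 2
      have r: "2 * int m + 2 * int r + 2 = 2 * int m + 3 + int r" using 2 by simp
      have top: "ivl 1 (2 * int m + 3 + int r) = add_mset (2 * int m + 2 + int r) (ivl 1 (2 * int m + 2 + int r))"
        by (rule ivl_snoc') simp_all
      have next_top: "ivl 1 (2 * int m + 2 + int r) = add_mset (2 * int m + 2) (ivl 1 (2 * int m + 2))"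
        using 2 by (intro ivl_snoc') simp_all
      show ?thesis unfolding r top next_top by simp
    qed
    have all: "ivl 1 (int (6 * m + 6 + 3 * r) + 1)
        = ivl 1 (2 * int m + 3 + int r) + ivl (2 * int m + 3 + int r) (6 * int m + 7 + 3 * int r)"
      by (subst ivl_join) (simp_all add: algebra_simps)
    show "labels (Suc a + Suc b) y + labels (Suc a + Suc b) y
        + labels (Suc a + Suc b) (\<lambda>j. y j + y (cyc_pred (Suc a + Suc b) j))
        = ivl 1 (int (6 * m + 6 + 3 * r) + 1) + ivl 1 (int (6 * m + 6 + 3 * r) + 1)"
      unfolding yl xl low all by (simp only: union_ac)
  qed
  then show ?thesis unfolding n .
qed

text \<open>Here \<open>y\<close> covers 2m+3, ..., 6m+7. The sums inside \<open>u\<close> and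
  \<open>v\<close> give 1, ..., 2m+2 and 1, ..., 2m+1; one junction supplies the missing 2m+2, the
  other the label 6m+8 that only the longer list has.\<close>

lemma ex_scheme_three_odd:
  "\<exists>F. scheme (4 * m + 5) {0, 1, 2} F (6 * m + 7) (6 * m + 8)"
proof -
  define u where "u = (\<lambda>i. - zig (5 * int m + 6) (- (5 * int m + 7)) i)"
  define v where "v = zig (- (2 * int m + 3)) (4 * int m + 4)"
  define a b where "a = 2 * (m + 1)" and "b = 2 * m + 1"
  define y where "y = join_at (Suc a) u v"
  have n: "4 * m + 5 = Suc a + Suc b" by (simp add: a_def b_def)
  have u: "u (Suc i) + u i = 1 + int i" for i
    using zig_step [of "5 * int m + 6" "- (5 * int m + 7)" i] by (simp add: u_def)
  have v: "v (Suc i) + v i = 2 * int m + 1 - int i" for i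
    using zig_step [of "- (2 * int m + 3)" "4 * int m + 4" i] by (simp add: v_def)
  have yl: "labels (Suc a + Suc b) y = ivl (2 * int m + 3) (6 * int m + 8)"
  proof -
    have "labels (Suc a) u = ivl (4 * int m + 5) (5 * int m + 7) + ivl (5 * int m + 7) (6 * int m + 8)"
      unfolding u_def labels_uminus by (subst labels_zig_pos) (simp_all add: a_def algebra_simps)
    moreover have "labels (Suc b) v = ivl (2 * int m + 3) (3 * int m + 4) + ivl (3 * int m + 4) (4 * int m + 5)"
      unfolding v_def by (subst labels_zig_neg) (simp_all add: b_def algebra_simps)
    ultimately show ?thesis
      unfolding y_def labels_join_at by (simp add: ivl_join union_commute)
  qed
  have ends: "\<bar>u 0 + v b + 0\<bar> = 2 * int m + 2" "\<bar>v 0 + u a + 0\<bar> = 6 * int m + 8"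
    unfolding a_def b_def u_def v_def zig_even zig_odd zig_0 by simp_all
  have xl: "labels (Suc a + Suc b) (\<lambda>j. y j + y (cyc_pred (Suc a + Suc b) j)) =
      {#2 * int m + 2, 6 * int m + 8#} + ivl 1 (2 * int m + 3) + ivl 1 (2 * int m + 2)"
  proof -
    have "labels a (\<lambda>i. u (Suc i) + u i + 0) = ivl 1 (2 * int m + 3)"
      by (rule trans [OF labels_eq_ivl_up [of 1] arg_cong [of _ _ "ivl 1"]]) (auto simp: u a_def)
    moreover have "labels b (\<lambda>i. v (Suc i) + v i + 0) = ivl 1 (2 * int m + 2)"
      by (rule trans [OF labels_eq_ivl_down [of _ "2 * int m + 1"] arg_cong2 [of _ _ _ _ ivl]]) (auto simp: v b_def)
    ultimately show ?thesis
      using labels_join_at_adjacent [of a b u v "\<lambda>_. 0"] ends by (simp add: y_def)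
  qed
  have "\<exists>F. scheme (Suc a + Suc b) {0, 1, 2} F (6 * m + 7) (6 * m + 8)"
  proof (rule scheme_three)
    show "3 \<le> Suc a + Suc b" by (simp add: a_def b_def)
    have "ivl 1 (int (6 * m + 7) + 1) = ivl 1 (2 * int m + 3) + ivl (2 * int m + 3) (6 * int m + 8)"
      by (subst ivl_join) (simp_all add: algebra_simps)
    moreover have "ivl 1 (int (6 * m + 8) + 1) = add_mset (6 * int m + 8)
        (add_mset (2 * int m + 2) (ivl 1 (2 * int m + 2)) + ivl (2 * int m + 3) (6 * int m + 8))"
      using ivl_snoc [of 1 "6 * int m + 8"] ivl_snoc [of 1 "2 * int m + 2"]
        ivl_join [of 1 "2 * int m + 3" "6 * int m + 8"] by (simp add: algebra_simps)
    ultimately show "labels (Suc a + Suc b) y + labels (Suc a + Suc b) y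
        + labels (Suc a + Suc b) (\<lambda>j. y j + y (cyc_pred (Suc a + Suc b) j))
        = ivl 1 (int (6 * m + 7) + 1) + ivl 1 (int (6 * m + 8) + 1)"
      unfolding yl xl by (simp add: ac_simps)
  qed
  then show ?thesis unfolding n .
qed

text \<open>T is 0 on one half of the cycle and 1 on the other, so it shifts only one of the two runs of
  neighbour sums; its exceptional values make the sequence c on the diagonal pair close up.\<close>

lemma ex_scheme_five_odd:
  "\<exists>F. scheme (4 * m + 7) {0, 1, 2, 2 * m + 4, 2 * m + 5} F (10 * m + 17) (10 * m + 18)"
proof -
  define L where "L = 2 * m + 3"
  define u where "u = (\<lambda>i. - zig (3 * int m + 5) (- (3 * int m + 6)) i)"
  define v where "v = zig (6 * int m + 10) (- (4 * int m + 8))"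
  define a b where "a = 2 * (m + 1) + 1" and "b = 2 * (m + 1)"
  define y where "y = join_at (Suc a) u v"
  define T where "T = (\<lambda>j. if j = 0 then - int L else if j \<le> L then 0 else 1)"
  \<comment> \<open>The row condition reads \<open>c x - c (x + 1) = T (x - L) - T (x + 1)\<close>
    with cyclic indices, so \<open>T\<close> determines \<open>c\<close> up to a constant; this
    constant puts the values on 6m+11, ..., 10m+17.\<close>
  define c where "c = (\<lambda>j. if j \<le> L then 8 * int m + 14 - int j else 8 * int m + 14 + int j - int L)"
  have n: "4 * m + 7 = Suc a + Suc b" "4 * m + 7 = Suc (L + L)" "4 * m + 7 = Suc L + L"
    by (simp_all add: a_def b_def L_def)
  have u: "u (Suc i) + u i = 1 + int i" for i
    using zig_step [of "3 * int m + 5" "- (3 * int m + 6)" i] by (simp add: u_def)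
  have v: "v (Suc i) + v i = 2 * int m + 2 - int i" for i
    using zig_step [of "6 * int m + 10" "- (4 * int m + 8)" i] by (simp add: v_def)
  have yl: "labels (4 * m + 7) y = ivl (2 * int m + 4) (6 * int m + 11)"
  proof -
    have "labels (Suc a) u = ivl (2 * int m + 4) (3 * int m + 6) + ivl (3 * int m + 6) (4 * int m + 8)"
      unfolding u_def labels_uminus by (subst labels_zig_pos) (simp_all add: a_def algebra_simps)
    moreover have "labels (Suc b) v = ivl (5 * int m + 9) (6 * int m + 11) + ivl (4 * int m + 8) (5 * int m + 9)"
      unfolding v_def by (subst labels_zig_pos) (simp_all add: b_def algebra_simps)
    ultimately show ?thesis
      unfolding y_def n(1) labels_join_at by (simp add: ivl_join union_commute)
  qed
  \<comment> \<open>The value \<open>T 0 = - L\<close> lowers the sum L + 1 at the first junction to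
    1, which the run inside \<open>v\<close> lacks; the second junction gives the top label of the
    longer list.\<close>
  have ends: "\<bar>u 0 + v b + T 0\<bar> = 1" "\<bar>v 0 + u a + T (Suc a)\<bar> = 10 * int m + 18"
    unfolding a_def b_def u_def v_def zig_even zig_odd zig_0 by (simp_all add: T_def L_def)
  have xl: "labels (4 * m + 7) (\<lambda>j. y j + y (cyc_pred (4 * m + 7) j) + T j) =
      {#1, 10 * int m + 18#} + ivl 1 (2 * int m + 4) + ivl 2 (2 * int m + 4)"
  proof -
    have "labels a (\<lambda>i. u (Suc i) + u i + T (Suc i)) = ivl 1 (2 * int m + 4)"
      by (rule trans [OF labels_eq_ivl_up [of 1] arg_cong [of _ _ "ivl 1"]]) (auto simp: u a_def T_def L_def)
    moreover have "labels b (\<lambda>i. v (Suc i) + v i + T (Suc (Suc a) + i)) = ivl 2 (2 * int m + 4)"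
      by (rule trans [OF labels_eq_ivl_down [of _ "2 * int m + 3"] arg_cong2 [of _ _ _ _ ivl]]) (auto simp: v a_def b_def T_def L_def)
    ultimately show ?thesis
      using labels_join_at_adjacent [of a b u v T] ends by (simp only: y_def n(1))
  qed
  have cl: "labels (4 * m + 7) c = ivl (6 * int m + 11) (10 * int m + 18)"
  proof -
    have "labels (Suc L) c = ivl (6 * int m + 11) (8 * int m + 15)"
      by (rule trans [OF labels_eq_ivl_down [of _ "8 * int m + 14"] arg_cong2 [of _ _ _ _ ivl]]) (auto simp: c_def L_def)
    moreover have "labels L (\<lambda>i. c (Suc L + i)) = ivl (8 * int m + 15) (10 * int m + 18)"
      by (rule trans [OF labels_eq_ivl_up [of "8 * int m + 15"] arg_cong [of _ _ "ivl (8 * int m + 15)"]]) (auto simp: c_def L_def)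
    ultimately show ?thesis unfolding n(3) labels_add by (simp add: ivl_join)
  qed
  have dl: "labels (4 * m + 7) (\<lambda>j. T j - c j) = ivl (6 * int m + 11) (10 * int m + 18)"
  proof -
    have "labels L (\<lambda>i. T (Suc i) - c (Suc i)) = ivl (6 * int m + 11) (8 * int m + 14)"
      by (rule trans [OF labels_eq_ivl_down [of _ "8 * int m + 13"] arg_cong2 [of _ _ _ _ ivl]]) (auto simp: T_def c_def L_def)
    moreover have "\<bar>T 0 - c 0\<bar> = 10 * int m + 17"
      by (simp add: T_def c_def L_def)
    moreover have "labels L (\<lambda>i. T (Suc L + i) - c (Suc L + i)) = ivl (8 * int m + 14) (10 * int m + 17)"
      by (rule trans [OF labels_eq_ivl_up [of "8 * int m + 14"] arg_cong [of _ _ "ivl (8 * int m + 14)"]]) (auto simp: T_def c_def L_def)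
    moreover have "ivl (6 * int m + 11) (10 * int m + 18)
        = add_mset (10 * int m + 17) (ivl (6 * int m + 11) (10 * int m + 17))"
      by (rule ivl_snoc') simp_all
    ultimately show ?thesis
      unfolding n(3) labels_add labels_Suc_shift by (simp add: ivl_join)
  qed
  have "\<exists>F. scheme (4 * m + 7) {0, 1, 2, L + 1, L + 2} F (10 * m + 17) (10 * m + 18)"
  proof (rule scheme_five)
    show "2 \<le> L" "L + 2 < 4 * m + 7" by (simp_all add: L_def)
    fix t assume t: "t < 4 * m + 7"
    \<comment> \<open>The cases separate the places where \<open>t + L\<close> or
      \<open>t + L + 1\<close> wraps round or an exceptional value of \<open>T\<close>
      enters.\<close>
    consider "t = 0" | "1 \<le> t" "t < L" | "t = L" | "t = L + 1" | "L + 2 \<le> t" by linarith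
    then show "c ((t + L) mod (4 * m + 7)) - c ((t + L + 1) mod (4 * m + 7)) + T ((t + L + 1) mod (4 * m + 7)) = T t"
    proof cases
      case 1
      then show ?thesis unfolding n(2) by (simp add: c_def T_def L_def)
    next
      case 2
      then have "(t + L) mod Suc (L + L) = t + L" "(t + L + 1) mod Suc (L + L) = t + L + 1" by simp_all
      then show ?thesis unfolding n(2) using 2 by (simp add: c_def T_def)
    next
      case 3
      then show ?thesis unfolding n(2) by (simp add: c_def T_def L_def)
    next
      case 4
      then have e: "t + L = Suc (L + L)" by simp
      have "0 < L" by (simp add: L_def)
      then have "(t + L) mod Suc (L + L) = 0" "(t + L + 1) mod Suc (L + L) = 1"
        unfolding e by (simp_all add: mod_Suc)
      then show ?thesis unfolding n(2) using 4 by (simp add: c_def T_def L_def)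
    next
      case 5
      then have "(t + L) mod Suc (L + L) = t - L - 1" "(t + L + 1) mod Suc (L + L) = t - L"
        using t n(2) by (auto simp: mod_if)
      then show ?thesis unfolding n(2) using 5 t n(2) by (simp add: c_def T_def of_nat_diff)
    qed
  next
    have "ivl 1 (int (10 * m + 17) + 1) = ivl 1 (2 * int m + 4) + ivl (2 * int m + 4) (6 * int m + 11)
        + ivl (6 * int m + 11) (10 * int m + 18)"
      by (simp add: ivl_join add.commute)
    moreover have "ivl 1 (int (10 * m + 18) + 1) = add_mset 1 (ivl 2 (2 * int m + 4)) + ivl (2 * int m + 4) (6 * int m + 11)
        + add_mset (10 * int m + 18) (ivl (6 * int m + 11) (10 * int m + 18))"
      using ivl_cons [of 2 "2 * int m + 4"] ivl_snoc [of "6 * int m + 11" "10 * int m + 18"]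
        ivl_join [of 1 "2 * int m + 4" "6 * int m + 11"] ivl_join [of 1 "6 * int m + 11" "10 * int m + 19"]
      by (simp add: algebra_simps)
    ultimately show "labels (4 * m + 7) y + labels (4 * m + 7) y
        + labels (4 * m + 7) (\<lambda>j. y j + y (cyc_pred (4 * m + 7) j) + T j)
        + labels (4 * m + 7) c + labels (4 * m + 7) (\<lambda>j. T j - c j)
        = ivl 1 (int (10 * m + 17) + 1) + ivl 1 (int (10 * m + 18) + 1)"
      unfolding yl xl cl dl by (simp add: ac_simps)
  qed
  moreover have "L + 1 = 2 * m + 4" "L + 2 = 2 * m + 5" by (simp_all add: L_def)
  ultimately show ?thesis by (simp only:)
qed

text \<open>Now n = 2L, so the shift by L exchanges the positions 0 and L, and \<open>T\<close> is
  exceptional at both. The sequence \<open>y\<close> covers 2m+7, ..., 3m+7 by \<open>u\<close> and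
  4m+11, ..., 5m+15 by \<open>v\<close>. The extra pair of diagonals covers m+4, ..., 2m+5 and 3m+8,
  ..., 4m+10 twice, and m+3 and 2m+6 once; the corrected neighbour sums give the rest.\<close>

lemma ex_scheme_five_even:
  "\<exists>F. scheme (2 * m + 6) {0, 1, 2, m + 4, m + 5} F (5 * m + 15) (5 * m + 15)"
proof -
  define L where "L = m + 3"
  \<comment> \<open>The last term \<open>u m\<close> is negative for even m and positive for odd m.
    Giving \<open>A\<close> the opposite sign makes the junction sum \<open>v 0 + u m\<close> equal
    to 2m + 6 in absolute value in both cases.\<close>
  define A where "A = (if even m then 9 * int (m div 2) + 13 else - (9 * int (m div 2) + 18))"
  define u where "u = zig (- (2 * int m + 7)) (3 * int m + 7)"
  define v where "v = zig A (- (A + 1))"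
  define y where "y = join_at (Suc m) u v"
  define T where "T = (\<lambda>j. if j = 0 then - int (m + 2) else if j < L then 0 else if j = L then int L else 1)"
  define c where "c = (\<lambda>j. if j = 0 then 3 * int m + 8 else if j < L then 2 * int m + 6 - int j
    else if j = L then 2 * int m + 6 else 2 * int m + 5 + int j)"
  have n: "2 * m + 6 = Suc m + Suc (m + 4)" "2 * m + 6 = 2 * L" "2 * m + 6 = Suc (m + 2) + Suc (m + 2)"
    by (simp_all add: L_def)
  have u: "u (Suc i) + u i = int m - int i" for i
    using zig_step [of "- (2 * int m + 7)" "3 * int m + 7" i] by (simp add: u_def)
  have v: "v (Suc i) + v i = - 1 - int i" for i
    using zig_step [of A "- (A + 1)" i] by (simp add: v_def)
  have 0: "u 0 = - (2 * int m + 7)" "v 0 = A" by (simp_all add: u_def v_def)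
  have parity: "labels (Suc m) u = ivl (2 * int m + 7) (3 * int m + 8) \<and>
    labels (Suc (m + 4)) v = ivl (4 * int m + 11) (5 * int m + 16) \<and>
    u 0 + v (m + 4) + T 0 = int m + 2 \<and> \<bar>v 0 + u m + T (Suc m)\<bar> = 2 * int m + 6"
  proof (cases "even m")
    case True
    then obtain j where m: "m = 2 * j" by (elim evenE)
    have A: "A = 9 * int j + 13" by (simp add: A_def m)
    have "labels (Suc m) u = ivl (4 * int j + 7) (5 * int j + 8) + ivl (5 * int j + 8) (6 * int j + 8)"
      unfolding u_def by (subst labels_zig_neg) (simp_all add: m algebra_simps)
    moreover have "labels (Suc (m + 4)) v = ivl (8 * int j + 11) (9 * int j + 14) + ivl (9 * int j + 14) (10 * int j + 16)"
      unfolding v_def A by (subst labels_zig_pos) (simp_all add: m algebra_simps)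
    moreover have "v (m + 4) = A - int j - 2"
    proof -
      have 4: "m + 4 = 2 * (j + 2)" by (simp add: m)
      show ?thesis unfolding v_def 4 zig_even by simp
    qed
    moreover have "u m = - (2 * int m + 7) - int j"
      unfolding u_def m by simp
    ultimately show ?thesis
      by (simp add: ivl_join m A T_def L_def 0)
  next
    case False
    then obtain j where m: "m = 2 * j + 1" by (elim oddE)
    have A: "A = - (9 * int j + 18)" by (simp add: A_def m)
    have "labels (Suc m) u = ivl (4 * int j + 9) (5 * int j + 10) + ivl (5 * int j + 10) (6 * int j + 11)"
      unfolding u_def by (subst labels_zig_neg) (simp_all add: m algebra_simps)
    moreover have "labels (Suc (m + 4)) v = ivl (9 * int j + 18) (10 * int j + 21) + ivl (8 * int j + 15) (9 * int j + 18)"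
      unfolding v_def A by (subst labels_zig_neg) (simp_all add: m algebra_simps)
    moreover have "v (m + 4) = - (A + 1) - int j - 2"
    proof -
      have 4: "m + 4 = 2 * (j + 2) + 1" by (simp add: m)
      show ?thesis unfolding v_def 4 zig_odd by simp
    qed
    moreover have "u m = 3 * int m + 7 - int j"
      unfolding u_def m zig_odd by simp
    moreover have e: "2 * int m + 7 = 4 * int j + 9" "3 * int m + 8 = 6 * int j + 11"
      "4 * int m + 11 = 8 * int j + 15" "5 * int m + 16 = 10 * int j + 21" and im: "int m = 2 * int j + 1"
      by (simp_all add: m)
    ultimately show ?thesis
      unfolding e by (simp add: ivl_join union_commute im A T_def L_def 0)
  qed
  have yl: "labels (2 * m + 6) y = ivl (2 * int m + 7) (3 * int m + 8) + ivl (4 * int m + 11) (5 * int m + 16)"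
    unfolding y_def n(1) labels_join_at using parity by simp
  have xl: "labels (2 * m + 6) (\<lambda>j. y j + y (cyc_pred (2 * m + 6) j) + T j) =
      {#int m + 2, 2 * int m + 6, 1, int m + 1#} + ivl 1 (int m + 1) + ivl 2 (int m + 4)"
  proof -
    have 1: "labels m (\<lambda>i. u (Suc i) + u i + T (Suc i)) = ivl 1 (int m + 1)"
      by (rule trans [OF labels_eq_ivl_down [of _ "int m"] arg_cong2 [of _ _ _ _ ivl]]) (auto simp: u T_def L_def)
    have "labels (m + 2) (\<lambda>i. v (Suc (2 + i)) + v (2 + i) + T (Suc (Suc m) + (2 + i))) = ivl 2 (int m + 4)"
      by (rule trans [OF labels_eq_ivl_up [of 2] arg_cong [of _ _ "ivl 2"]]) (auto simp: v T_def L_def)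
    \<comment> \<open>The first two sums inside \<open>v\<close> fall on the indices L - 1 and L,
      where \<open>T\<close> is 0 and L; only after them is \<open>T\<close> equal to 1.\<close>
    moreover have "labels 2 (\<lambda>i. v (Suc i) + v i + T (Suc (Suc m) + i)) = {#1, int m + 1#}"
      by (simp add: numeral_2_eq_2 labels_Suc v T_def L_def)
    moreover have "m + 4 = 2 + (m + 2)" by simp
    ultimately have 2: "labels (m + 4) (\<lambda>i. v (Suc i) + v i + T (Suc (Suc m) + i)) = {#1, int m + 1#} + ivl 2 (int m + 4)"
      by (simp only: labels_add)
    have "labels (Suc m + Suc (m + 4)) (\<lambda>j. y j + y (cyc_pred (Suc m + Suc (m + 4)) j) + T j) =
        {#int m + 2, 2 * int m + 6#} + ivl 1 (int m + 1) + ({#1, int m + 1#} + ivl 2 (int m + 4))"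
      unfolding y_def labels_join_at_adjacent 1 2 using parity by simp
    then show ?thesis unfolding n(1) by simp
  qed
  have cl: "labels (2 * m + 6) c = {#3 * int m + 8, 2 * int m + 6#} + ivl (int m + 4) (2 * int m + 6)
      + ivl (3 * int m + 9) (4 * int m + 11)"
  proof -
    have "labels (m + 2) (\<lambda>i. c (Suc i)) = ivl (int m + 4) (2 * int m + 6)"
      by (rule trans [OF labels_eq_ivl_down [of _ "2 * int m + 5"] arg_cong2 [of _ _ _ _ ivl]]) (auto simp: c_def L_def)
    moreover have "labels (m + 2) (\<lambda>i. c (Suc (m + 2) + Suc i)) = ivl (3 * int m + 9) (4 * int m + 11)"
      by (rule trans [OF labels_eq_ivl_up [of "3 * int m + 9"] arg_cong [of _ _ "ivl (3 * int m + 9)"]]) (auto simp: c_def L_def)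
    moreover have "\<bar>c 0\<bar> = 3 * int m + 8" "\<bar>c (Suc (m + 2) + 0)\<bar> = 2 * int m + 6"
      by (simp_all add: c_def L_def)
    ultimately show ?thesis unfolding n(3) labels_add labels_Suc_shift by simp
  qed
  have dl: "labels (2 * m + 6) (\<lambda>j. T j - c j) = {#4 * int m + 10, int m + 3#} + ivl (int m + 4) (2 * int m + 6)
      + ivl (3 * int m + 8) (4 * int m + 10)"
  proof -
    have "labels (m + 2) (\<lambda>i. T (Suc i) - c (Suc i)) = ivl (int m + 4) (2 * int m + 6)"
      by (rule trans [OF labels_eq_ivl_down [of _ "2 * int m + 5"] arg_cong2 [of _ _ _ _ ivl]]) (auto simp: c_def T_def L_def)
    moreover have "labels (m + 2) (\<lambda>i. T (Suc (m + 2) + Suc i) - c (Suc (m + 2) + Suc i)) = ivl (3 * int m + 8) (4 * int m + 10)"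
      by (rule trans [OF labels_eq_ivl_up [of "3 * int m + 8"] arg_cong [of _ _ "ivl (3 * int m + 8)"]]) (auto simp: c_def T_def L_def)
    moreover have "\<bar>T 0 - c 0\<bar> = 4 * int m + 10" "\<bar>T (Suc (m + 2) + 0) - c (Suc (m + 2) + 0)\<bar> = int m + 3"
      by (simp_all add: c_def T_def L_def)
    ultimately show ?thesis unfolding n(3) labels_add labels_Suc_shift by simp
  qed
  have "\<exists>F. scheme (2 * m + 6) {0, 1, 2, L + 1, L + 2} F (5 * m + 15) (5 * m + 15)"
  proof (rule scheme_five)
    show "2 \<le> L" "L + 2 < 2 * m + 6" by (simp_all add: L_def)
    fix t assume t: "t < 2 * m + 6"
    consider "t = 0" | "1 \<le> t" "t < L - 1" | "t = L - 1" | "t = L" | "L < t" "t < 2 * L - 1" | "t = 2 * L - 1"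
      using t n(2) by linarith
    then show "c ((t + L) mod (2 * m + 6)) - c ((t + L + 1) mod (2 * m + 6)) + T ((t + L + 1) mod (2 * m + 6)) = T t"
    proof cases
      case 1
      then show ?thesis by (simp add: c_def T_def L_def)
    next
      case 2
      then have "(t + L) mod (2 * L) = t + L" "(t + L + 1) mod (2 * L) = t + L + 1" by simp_all
      moreover have "t < L" "t \<noteq> L" using 2 by linarith+
      ultimately show ?thesis unfolding n(2) using 2 by (simp add: c_def T_def)
    next
      case 3
      have "0 < L" by (simp add: L_def)
      with 3 have e: "t + L = 2 * L - 1" "t + L + 1 = 2 * L" by linarith+
      have "(t + L) mod (2 * L) = 2 * L - 1" "(t + L + 1) mod (2 * L) = 0"
        unfolding e using \<open>0 < L\<close> by simp_all
      then show ?thesis unfolding n(2) using 3 by (simp add: c_def T_def L_def)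
    next
      case 4
      then have "(t + L) mod (2 * L) = 0" "(t + L + 1) mod (2 * L) = 1" by (simp_all add: L_def mod_if)
      then show ?thesis unfolding n(2) using 4 by (simp add: c_def T_def L_def)
    next
      case 5
      then have "(t + L) mod (2 * L) = t - L" "(t + L + 1) mod (2 * L) = t - L + 1" by (auto simp: mod_if)
      moreover have "t - L + 1 < L" "0 < L" using 5 by linarith+
      ultimately show ?thesis unfolding n(2) using 5 by (simp add: c_def T_def)
    next
      case 6
      then have "(t + L) mod (2 * L) = L - 1" "(t + L + 1) mod (2 * L) = L" by (auto simp: mod_if L_def)
      then show ?thesis unfolding n(2) using 6 by (simp add: c_def T_def L_def)
    qed
  next
    \<comment> \<open>The list 1, ..., 5m+15 is cut up in two ways, \<open>R1\<close> and
      \<open>R2\<close>, which together use exactly the pieces of \<open>yl\<close> (taken twice),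
      \<open>xl\<close>, \<open>cl\<close> and \<open>dl\<close>.\<close>
    have all: "ivl 1 (5 * int m + 16) = ivl 1 (int m + 4) + ivl (int m + 4) (2 * int m + 7)
        + ivl (2 * int m + 7) (3 * int m + 8) + ivl (3 * int m + 8) (4 * int m + 11) + ivl (4 * int m + 11) (5 * int m + 16)"
      by (simp add: ivl_join)
    have mid: "ivl (int m + 4) (2 * int m + 7) = add_mset (2 * int m + 6) (ivl (int m + 4) (2 * int m + 6))"
      by (rule ivl_snoc') simp_all
    have "ivl 1 (int m + 2) = add_mset (int m + 1) (ivl 1 (int m + 1))"
      "ivl 1 (int m + 3) = add_mset (int m + 2) (ivl 1 (int m + 2))"
      "ivl 1 (int m + 4) = add_mset (int m + 3) (ivl 1 (int m + 3))"
      by (rule ivl_snoc'; simp)+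
    then have "ivl 1 (int m + 4) = ivl 1 (int m + 1) + {#int m + 1, int m + 2, int m + 3#}"
      by simp
    moreover have "ivl (3 * int m + 8) (4 * int m + 11) = add_mset (3 * int m + 8) (ivl (3 * int m + 9) (4 * int m + 11))"
      by (rule ivl_cons') simp_all
    ultimately have R1: "ivl 1 (5 * int m + 16) = ivl 1 (int m + 1) + {#int m + 1, int m + 2, int m + 3#}
        + add_mset (2 * int m + 6) (ivl (int m + 4) (2 * int m + 6)) + ivl (2 * int m + 7) (3 * int m + 8)
        + add_mset (3 * int m + 8) (ivl (3 * int m + 9) (4 * int m + 11)) + ivl (4 * int m + 11) (5 * int m + 16)"
      using all mid by (simp only:)
    have "ivl 1 (int m + 4) = add_mset 1 (ivl 2 (int m + 4))"
      by (rule ivl_cons') simp_all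
    moreover have "ivl (3 * int m + 8) (4 * int m + 11) = add_mset (4 * int m + 10) (ivl (3 * int m + 8) (4 * int m + 10))"
      by (rule ivl_snoc') simp_all
    ultimately have R2: "ivl 1 (5 * int m + 16) = add_mset 1 (ivl 2 (int m + 4))
        + add_mset (2 * int m + 6) (ivl (int m + 4) (2 * int m + 6)) + ivl (2 * int m + 7) (3 * int m + 8)
        + add_mset (4 * int m + 10) (ivl (3 * int m + 8) (4 * int m + 10)) + ivl (4 * int m + 11) (5 * int m + 16)"
      using all mid by (simp only:)
    have "labels (2 * m + 6) y + labels (2 * m + 6) y
        + labels (2 * m + 6) (\<lambda>j. y j + y (cyc_pred (2 * m + 6) j) + T j)
        + labels (2 * m + 6) c + labels (2 * m + 6) (\<lambda>j. T j - c j)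
        = (ivl 1 (int m + 1) + {#int m + 1, int m + 2, int m + 3#}
        + add_mset (2 * int m + 6) (ivl (int m + 4) (2 * int m + 6)) + ivl (2 * int m + 7) (3 * int m + 8)
        + add_mset (3 * int m + 8) (ivl (3 * int m + 9) (4 * int m + 11)) + ivl (4 * int m + 11) (5 * int m + 16))
        + (add_mset 1 (ivl 2 (int m + 4))
        + add_mset (2 * int m + 6) (ivl (int m + 4) (2 * int m + 6)) + ivl (2 * int m + 7) (3 * int m + 8)
        + add_mset (4 * int m + 10) (ivl (3 * int m + 8) (4 * int m + 10)) + ivl (4 * int m + 11) (5 * int m + 16))"
      unfolding yl xl cl dl
      by (simp only: add_mset_add_single [of _ "ivl _ _"] add_mset_add_single [of _ "add_mset _ _"]
          add_mset_add_single [of _ "_ + _"] union_ac)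
    moreover have "int (5 * m + 15) + 1 = 5 * int m + 16" by simp
    ultimately show "labels (2 * m + 6) y + labels (2 * m + 6) y
        + labels (2 * m + 6) (\<lambda>j. y j + y (cyc_pred (2 * m + 6) j) + T j)
        + labels (2 * m + 6) c + labels (2 * m + 6) (\<lambda>j. T j - c j)
        = ivl 1 (int (5 * m + 15) + 1) + ivl 1 (int (5 * m + 15) + 1)"
      by (simp only: R1 [symmetric] R2 [symmetric])
  qed
  moreover have "L + 1 = m + 4" "L + 2 = m + 5" by (simp_all add: L_def)
  ultimately show ?thesis by (simp only:)
qed

section \<open>Choice of base case by k modulo 4 and placement of the added diagonals\<close>

lemma ex_is_H2_square:
  assumes "3 \<le> k" "k \<le> n" "(n * k) mod 4 \<noteq> 1"
  shows "\<exists>A. is_H2 n k A"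
proof -
  have nk: "(n mod 4) * (k mod 4) mod 4 \<noteq> 1" using assms(3) by (simp add: mod_mult_eq)
  have "k mod 4 < 4" "n mod 4 < 4" by simp_all
  then consider "k mod 4 = 0" | "k mod 4 = 1" | "k mod 4 = 2" | "k mod 4 = 3" by linarith
  then show ?thesis
  proof cases
    case 1
    define t where "t = k div 4"
    have k: "k = 4 * t" using 1 unfolding t_def by presburger
    show ?thesis
    proof (rule ex_is_H2 [OF scheme_empty, where t = t and g = "\<lambda>i. 2 * i"])
      show "2 * i \<notin> {} \<and> Suc (2 * i) \<notin> {} \<and> Suc (2 * i) < n" if "i < 2 * t" for i
        using that k assms(2) by simp
    qed (simp_all add: k)
  next
    case 2
    define t where "t = k div 4 - 1"
    have k: "k = 5 + 4 * t" using 2 assms(1) unfolding t_def by presburger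
    have "n mod 4 \<noteq> 1" using nk 2 by auto
    with \<open>n mod 4 < 4\<close> have "n mod 4 = 0 \<or> n mod 4 = 2 \<or> n mod 4 = 3" by linarith
    then have "even n \<or> n mod 4 = 3" by presburger
    then consider "even n" | "n mod 4 = 3" by blast
    then show ?thesis
    proof cases
      case 1
      define m where "m = n div 2 - 3"
      have m: "n = 2 * m + 6" using 1 assms(2) k unfolding m_def by presburger
      obtain F where F: "scheme n {0, 1, 2, m + 4, m + 5} F (5 * m + 15) (5 * m + 15)"
        using ex_scheme_five_even [of m] unfolding m by (elim exE)
      \<comment> \<open>The free diagonals form blocks of m + 1 and m; they hold \<open>c\<close>
        and m div 2 adjacent pairs, m in total, and 2t <= m are needed.\<close>
      define c where "c = (m + 1) div 2"
      have c: "2 * c \<le> m + 1" "m \<le> 2 * c" unfolding c_def by linarith+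
      have t: "2 * t \<le> m" using assms(2) k m by linarith
      define g where "g = (\<lambda>i. if i < c then 3 + 2 * i else m + 6 + 2 * (i - c))"
      show ?thesis
      proof (rule ex_is_H2 [OF F, where t = t and g = g])
        show "g i \<notin> {0, 1, 2, m + 4, m + 5} \<and> Suc (g i) \<notin> {0, 1, 2, m + 4, m + 5} \<and> Suc (g i) < n" if "i < 2 * t" for i
        proof (cases "i < c")
          case True
          then have "g i = 3 + 2 * i" "2 * i + 2 \<le> m + 1" using c by (simp_all add: g_def)
          then show ?thesis using m by simp
        next
          case False
          then have "g i = m + 6 + 2 * (i - c)" "2 * (i - c) + 2 \<le> m" using c t that by (simp_all add: g_def)
          then show ?thesis using m by simp
        qed
        show "Suc (g i') < g i" if "i' < i" "i < 2 * t" for i i'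
          using that c unfolding g_def by (cases "i < c"; cases "i' < c") simp_all
      qed (simp_all add: m k)
    next
      case 2
      define m where "m = n div 4 - 1"
      have m: "n = 4 * m + 7" using 2 assms(2) k unfolding m_def by presburger
      obtain F where F: "scheme n {0, 1, 2, 2 * m + 4, 2 * m + 5} F (10 * m + 17) (10 * m + 18)"
        using ex_scheme_five_odd [of m] unfolding m by (elim exE)
      have t: "t \<le> m" using assms(2) k m by linarith
      \<comment> \<open>Both free blocks have 2m + 1 diagonals and hold m adjacent pairs each,
        enough since t <= m.\<close>
      define g where "g = (\<lambda>i. if i < m then 3 + 2 * i else 2 * m + 6 + 2 * (i - m))"
      show ?thesis
      proof (rule ex_is_H2 [OF F, where t = t and g = g])
        show "g i \<notin> {0, 1, 2, 2 * m + 4, 2 * m + 5} \<and> Suc (g i) \<notin> {0, 1, 2, 2 * m + 4, 2 * m + 5} \<and> Suc (g i) < n"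
          if "i < 2 * t" for i
        proof (cases "i < m")
          case True
          then have "g i = 3 + 2 * i" by (simp add: g_def)
          then show ?thesis using m True by simp
        next
          case False
          then have "g i = 2 * m + 6 + 2 * (i - m)" "i - m + 1 \<le> m" using t that by (simp_all add: g_def)
          then show ?thesis using m by simp
        qed
        show "Suc (g i') < g i" if "i' < i" "i < 2 * t" for i i'
          using that unfolding g_def by (cases "i < m"; cases "i' < m") simp_all
      qed (simp_all add: m k)
    qed
  next
    case 3
    define t where "t = k div 4 - 1"
    have k: "k = 6 + 4 * t" using 3 assms(1) unfolding t_def by presburger
    then have "6 \<le> n" using assms(2) by linarith
    from scheme_six [OF this] obtain F where F: "scheme n {0, 1, 2, 3, 4, 5} F (3 * n) (3 * n)"
      by (elim exE)
    show ?thesis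
    proof (rule ex_is_H2 [OF F, where t = t and g = "\<lambda>i. 6 + 2 * i"])
      show "6 + 2 * i \<notin> {0, 1, 2, 3, 4, 5} \<and> Suc (6 + 2 * i) \<notin> {0, 1, 2, 3, 4, 5} \<and> Suc (6 + 2 * i) < n"
        if "i < 2 * t" for i
        using that k assms(2) by simp
    qed (simp_all add: k)
  next
    case 4
    define t where "t = k div 4"
    have k: "k = 3 + 4 * t" using 4 unfolding t_def by presburger
    have n3: "n mod 4 \<noteq> 3" using nk 4 by auto
    have "\<exists>F p q. scheme n {0, 1, 2} F p q \<and> p + q = n * 3"
    proof (cases "even n")
      case True
      define m r where "m = n div 4 - 1" and "r = (n mod 4) div 2"
      have n: "n = 4 * m + 4 + 2 * r" using True assms unfolding m_def r_def by presburger
      have "r \<le> 1" unfolding r_def by presburger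
      from ex_scheme_three_even [OF this, of m] obtain F
        where "scheme n {0, 1, 2} F (6 * m + 6 + 3 * r) (6 * m + 6 + 3 * r)"
        unfolding n by (elim exE)
      moreover have "(6 * m + 6 + 3 * r) + (6 * m + 6 + 3 * r) = n * 3" by (simp add: n)
      ultimately show ?thesis by blast
    next
      case False
      define m where "m = n div 4 - 1"
      have n: "n = 4 * m + 5" using False n3 assms unfolding m_def by presburger
      from ex_scheme_three_odd [of m] obtain F where "scheme n {0, 1, 2} F (6 * m + 7) (6 * m + 8)"
        unfolding n by (elim exE)
      moreover have "(6 * m + 7) + (6 * m + 8) = n * 3" by (simp add: n)
      ultimately show ?thesis by blast
    qed
    then obtain F p q where F: "scheme n {0, 1, 2} F p q" and pq: "p + q = n * 3" by blast
    show ?thesis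
    proof (rule ex_is_H2 [OF F, where t = t and g = "\<lambda>i. 3 + 2 * i"])
      show "3 + 2 * i \<notin> {0, 1, 2} \<and> Suc (3 + 2 * i) \<notin> {0, 1, 2} \<and> Suc (3 + 2 * i) < n" if "i < 2 * t" for i
        using that k assms(2) by simp
    qed (simp_all add: k pq)
  qed
qed

subsection \<open>Necessity\<close>

lemma not_is_H2_two:
  assumes A: "is_H2 n 2 A" and n: "0 < n"
  shows False
proof -
  define v where "v = int (n * 2 + 1)"
  have range: "0 \<le> x \<and> x < v" if "A i j = Some x" for i j x
    using A that unfolding is_H2_def Let_def v_def by blast
  have rows: "card {j. j < n \<and> A i j \<noteq> None} = 2" "(\<Sum>j<n. cellval (A i j)) mod v = 0" if "i < n" for i
    using A that unfolding is_H2_def Let_def v_def by blast+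
  have cols: "card {i. i < n \<and> A i j \<noteq> None} = 2" "(\<Sum>i<n. cellval (A i j)) mod v = 0" if "j < n" for j
    using A that unfolding is_H2_def Let_def v_def by blast+
  have count: "count (entries n A + image_mset (\<lambda>y. (- y) mod v) (entries n A)) x \<le> 2" if "0 \<le> x" "x < v" for x
  proof -
    have "\<forall>x\<in>{0..<v}. count (entries n A + image_mset (\<lambda>y. (- y) mod v) (entries n A)) x = (if x = 0 then 0 else 2)"
      using A unfolding is_H2_def Let_def v_def by blast
    then show ?thesis using that by auto
  qed
  obtain j j' where j: "{j. j < n \<and> A 0 j \<noteq> None} = {j, j'}" "j \<noteq> j'"
    using rows(1) [OF n] by (auto simp: card_2_iff)
  then have "j \<in> {j. j < n \<and> A 0 j \<noteq> None}" "j' \<in> {j. j < n \<and> A 0 j \<noteq> None}" by auto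
  then obtain x y where x: "j < n" "A 0 j = Some x" and y: "j' < n" "A 0 j' = Some y" by auto
  have "\<exists>i. {i. i < n \<and> A i j \<noteq> None} = {0, i} \<and> i \<noteq> 0"
  proof -
    obtain a b where ab: "{i. i < n \<and> A i j \<noteq> None} = {a, b}" "a \<noteq> b"
      using cols(1) [OF x(1)] by (auto simp: card_2_iff)
    have "0 \<in> {i. i < n \<and> A i j \<noteq> None}" using n x by simp
    then consider "a = 0" | "b = 0" unfolding ab(1) by blast
    then show ?thesis
    proof cases
      case 1
      then show ?thesis using ab by (intro exI [of _ b]) simp
    next
      case 2
      then show ?thesis using ab by (intro exI [of _ a]) (simp add: insert_commute)
    qed
  qed
  then obtain i where i: "{i. i < n \<and> A i j \<noteq> None} = {0, i}" "i \<noteq> 0" by blast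
  then have "i \<in> {i. i < n \<and> A i j \<noteq> None}" by auto
  then obtain z where z: "i < n" "A i j = Some z" by auto
  have "(\<Sum>j<n. cellval (A 0 j)) = (\<Sum>j\<in>{j. j < n \<and> A 0 j \<noteq> None}. cellval (A 0 j))"
    by (rule sum.mono_neutral_right) (auto simp: cellval_def)
  also have "\<dots> = x + y" unfolding j(1) using j(2) x y by (simp add: cellval_def)
  finally have xy: "(x + y) mod v = 0" using rows(2) [OF n] by simp
  have "(\<Sum>i<n. cellval (A i j)) = (\<Sum>i\<in>{i. i < n \<and> A i j \<noteq> None}. cellval (A i j))"
    by (rule sum.mono_neutral_right) (auto simp: cellval_def)
  also have "\<dots> = x + z" unfolding i(1) using i(2) x z by (simp add: cellval_def)
  finally have xz: "(x + z) mod v = 0" using cols(2) [OF x(1)] by simp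
  have neg: "w = (- x) mod v" if "(x + w) mod v = 0" "0 \<le> w" "w < v" for w
  proof -
    have "v dvd x + w" using that(1) by (rule mod_0_imp_dvd)
    then have "w mod v = (- x) mod v"
      unfolding mod_eq_dvd_iff by (simp add: add.commute)
    then show ?thesis using that(2,3) by simp
  qed
  have yz: "y = (- x) mod v" "z = (- x) mod v"
    using neg [OF xy] neg [OF xz] range [OF y(2)] range [OF z(2)] by auto
  define C where "C = filled_cells n A"
  have fin: "finite C"
    by (rule finite_subset [of _ "{..<n} \<times> {..<n}"]) (auto simp: C_def filled_cells_def)
  have "{(0, j), (0, j'), (i, j)} \<subseteq> C"
    using x y z n by (auto simp: C_def filled_cells_def)
  then have "mset_set {(0, j), (0, j'), (i, j)} \<subseteq># mset_set C"
    using fin by (rule subset_imp_msubset_mset_set)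
  then have "image_mset (\<lambda>(i, j). the (A i j)) (mset_set {(0, j), (0, j'), (i, j)}) \<subseteq># entries n A"
    unfolding entries_def C_def by (rule image_mset_subseteq_mono)
  moreover have "image_mset (\<lambda>(i, j). the (A i j)) (mset_set {(0, j), (0, j'), (i, j)}) = {#x, y, z#}"
    using j(2) i(2) x y z by simp
  ultimately have sub: "{#x, y, z#} \<subseteq># entries n A" by simp
  \<comment> \<open>The class of -x occurs three times here: as y, as z and as the negative of
    x.\<close>
  have "{#x, y, z#} + image_mset (\<lambda>y. (- y) mod v) {#x, y, z#}
      \<subseteq># entries n A + image_mset (\<lambda>y. (- y) mod v) (entries n A)"
    using sub by (intro subset_mset.add_mono image_mset_subseteq_mono)
  from mset_subset_eq_count [OF this, of y]
  have "count ({#x, y, z#} + image_mset (\<lambda>y. (- y) mod v) {#x, y, z#}) y \<le> 2"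
    using count [of y] range [OF y(2)] by linarith
  moreover have "count ({#x, y, z#} + image_mset (\<lambda>y. (- y) mod v) {#x, y, z#}) y \<ge> 3"
    using yz by simp
  ultimately show False by simp
qed

lemma size_filter_odd_ivl: "size (filter_mset odd (ivl 0 (2 * int j))) = j"
proof (induction j)
  case (Suc j)
  have "ivl 0 (2 * int (Suc j)) = add_mset (2 * int j + 1) (ivl 0 (2 * int j + 1))"
    by (rule ivl_snoc') simp_all
  moreover have "ivl 0 (2 * int j + 1) = add_mset (2 * int j) (ivl 0 (2 * int j))"
    by (rule ivl_snoc') simp_all
  ultimately show ?case using Suc by simp
qed simp

lemma odd_sum_mset_iff: "odd (sum_mset E) \<longleftrightarrow> odd (size (filter_mset odd E))" for E :: "int multiset"
  by (induction E) auto

lemma is_H2_mod_4: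
  assumes A: "is_H2 n k A"
  shows "(n * k) mod 4 \<noteq> 1"
proof
  assume nk: "(n * k) mod 4 = 1"
  define v where "v = int (n * k + 1)"
  define q where "q = n * k div 4"
  \<comment> \<open>Half of v, which is odd because v is 2 modulo 4.\<close>
  define w where "w = 2 * q + 1"
  have "n * k = 4 * q + 1" using nk unfolding q_def by presburger
  then have v: "v = 2 * int w" unfolding v_def w_def by simp
  define E where "E = entries n A"
  define C where "C = filled_cells n A"
  have fin: "finite C"
    by (rule finite_subset [of _ "{..<n} \<times> {..<n}"]) (auto simp: C_def filled_cells_def)
  have rng: "0 \<le> x \<and> x < v" if "A i j = Some x" for i j x
    using A that unfolding is_H2_def Let_def v_def by blast
  have E_range: "0 \<le> x \<and> x < v" if "x \<in># E" for x
    using that fin rng by (auto simp: E_def entries_def C_def [symmetric]) (auto simp: C_def filled_cells_def)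
  \<comment> \<open>The definition fixes counts only within \<open>{0..<v}\<close>; as all entries
    and their reduced negatives lie there, this becomes an equality of multisets.\<close>
  have M: "E + image_mset (\<lambda>y. (- y) mod v) E = ivl 1 v + ivl 1 v"
  proof (rule multiset_eqI)
    fix x
    have *: "\<forall>x\<in>{0..<v}. count (E + image_mset (\<lambda>y. (- y) mod v) E) x = (if x = 0 then 0 else 2)"
      using A unfolding is_H2_def Let_def v_def E_def by blast
    show "count (E + image_mset (\<lambda>y. (- y) mod v) E) x = count (ivl 1 v + ivl 1 v) x"
    proof (cases "0 \<le> x \<and> x < v")
      case True
      then show ?thesis using * by (auto simp: ivl_def)
    next
      case False
      moreover have "0 < v" by (simp add: v w_def)
      ultimately have "x \<notin># E + image_mset (\<lambda>y. (- y) mod v) E" using E_range by auto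
      then have "count (E + image_mset (\<lambda>y. (- y) mod v) E) x = 0" by (simp only: not_in_iff)
      moreover have "count (ivl 1 v + ivl 1 v) x = 0" using False by (simp add: ivl_def)
      ultimately show ?thesis by (simp only:)
    qed
  qed
  \<comment> \<open>Since v is even, reduction modulo v keeps parity, so entries and negatives
    contribute equally many odd numbers. Two copies of 1, ..., v - 1 contain 2w of them, which
    leaves w among the entries.\<close>
  have "even ((- y) mod v) \<longleftrightarrow> even y" for y
    by (simp add: v dvd_mod_iff)
  then have "size (filter_mset odd (image_mset (\<lambda>y. (- y) mod v) X)) = size (filter_mset odd X)" for X
    by (induction X) simp_all
  then have "size (filter_mset odd (E + image_mset (\<lambda>y. (- y) mod v) E)) = 2 * size (filter_mset odd E)"
    by simp
  moreover have "size (filter_mset odd (ivl 1 v)) = w"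
  proof -
    have "ivl 0 v = add_mset 0 (ivl 1 v)" by (rule ivl_cons') (simp_all add: v w_def)
    then show ?thesis using size_filter_odd_ivl [of w] v by simp
  qed
  ultimately have "size (filter_mset odd E) = w" unfolding M by simp
  moreover have "odd w" by (simp add: w_def)
  ultimately have "odd (sum_mset E)" by (simp add: odd_sum_mset_iff)
  moreover have "v dvd sum_mset E"
  proof -
    have "sum_mset E = (\<Sum>(i, j)\<in>C. the (A i j))"
      by (simp add: E_def entries_def C_def sum_unfold_sum_mset)
    also have "\<dots> = (\<Sum>(i, j)\<in>C. cellval (A i j))"
      by (rule sum.cong) (auto simp: C_def filled_cells_def cellval_def)
    also have "\<dots> = (\<Sum>(i, j)\<in>{..<n} \<times> {..<n}. cellval (A i j))"
      by (rule sum.mono_neutral_left) (auto simp: C_def filled_cells_def cellval_def split: option.splits)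
    also have "\<dots> = (\<Sum>i<n. \<Sum>j<n. cellval (A i j))"
      by (simp add: sum.cartesian_product)
    also have "v dvd \<dots>"
    proof (rule dvd_sum)
      fix i assume "i \<in> {..<n}"
      then have "(\<Sum>j<n. cellval (A i j)) mod v = 0"
        using A unfolding is_H2_def Let_def v_def by blast
      then show "v dvd (\<Sum>j<n. cellval (A i j))" by (simp add: dvd_eq_mod_eq_0)
    qed
    finally show ?thesis .
  qed
  ultimately show False using v by (meson dvd_trans dvd_triv_left)
qed

theorem theorem4:
  fixes n k :: nat
  assumes "2 \<le> k" and "k \<le> n"
  shows "(\<exists>A. is_H2 n k A) \<longleftrightarrow> (3 \<le> k \<and> (n * k) mod 4 \<noteq> 1)"
proof
  assume "\<exists>A. is_H2 n k A"
  then obtain A where A: "is_H2 n k A" by blast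
  moreover have "k \<noteq> 2" using not_is_H2_two [of n A] A assms by auto
  ultimately show "3 \<le> k \<and> (n * k) mod 4 \<noteq> 1" using is_H2_mod_4 assms(1) by auto
next
  assume "3 \<le> k \<and> (n * k) mod 4 \<noteq> 1"
  then show "\<exists>A. is_H2 n k A" using ex_is_H2_square assms(2) by blast
qed

end
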